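(* Let $k\ge2$ be even, let $W_a$ be the affine Weyl group of type $\widetilde A_{k-1}$ acting on $\mathbb{R}^k$, with fundamental alcove $\mathcal A=\{y\in\mathbb{R}^k:1+y_k>y_1>\cdots>y_k\}$, and let $f(y_1,\dots,y_k)=f_1(y_1)\cdots f_k(y_k)$ for integrable functions $f_i:\mathbb{R}\to\mathbb{R}$. Then $$\int_{\mathcal A}\sum_{\omega\in W_a}\varepsilon(\omega)f(\omega y)\,dy=\mathrm{Pf}(J_{ij})_{i,j\in[k]},$$ where $$J_{ij}=\int_{\mathbb{R}^2}(-1)^{\lfloor y-z\rfloor}f_i(y)f_j(z)\,dy\,dz.$$
   Context: $[k]=\{1,\dots,k\}$. $W_a$ is the group of affine maps of $\mathbb{R}^k$ of the form $\omega(y)=w(y)+d$, with $w\in\mathfrak S_k$ permuting the canonical basis vectors and $d\in L=\{d\in\mathbb{Z}^k:\sum_id_i=0\}$; $\varepsilon(\omega)=\det w$ is the signature of the permutation. $\mathrm{Pf}$ denotes the Pfaffian: $\mathrm{Pf}(a_{ij})=\sum_\pi(-1)^{c(\pi)}\prod_{\{i<j\}\in\pi}a_{ij}$, summed over partitions $\pi$ of the index set into pairs, $c(\pi)$ being the number of crossings (pairs of blocks $\{i<j\},\{i'<j'\}$ with $i<i'<j<j'$). *)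

theory Defs
  imports "HOL-Analysis.Analysis" "HOL-Library.Disjoint_Sets"
begin

text \<open>
  The index set \<open>[k]\<close> is a type \<open>'n\<close> of sort \<open>{finite, linorder}\<close> with \<open>k = CARD('n)\<close>: such a
  type is order-isomorphic to \<open>{1,\<dots>,k}\<close> in exactly one way, with \<open>1\<close> and \<open>k\<close> corresponding to
  \<open>Min UNIV\<close> and \<open>Max UNIV\<close>.
\<close>

definition permutes_basis :: "(real^'n \<Rightarrow> real^'n) \<Rightarrow> bool" where
  "permutes_basis w \<longleftrightarrow>
     linear w \<and> (\<exists>\<sigma>. \<sigma> permutes UNIV \<and> (\<forall>i. w (axis i 1) = axis (\<sigma> i) 1))"

definition root_lattice :: "(real^'n) set" where
  "root_lattice = {d. (\<forall>i. d $ i \<in> \<int>) \<and> (\<Sum>i\<in>UNIV. d $ i) = 0}"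

definition affine_weyl :: "(real^'n \<Rightarrow> real^'n) set" where
  "affine_weyl = {\<omega>. \<exists>w d. permutes_basis w \<and> d \<in> root_lattice \<and> \<omega> = (\<lambda>y. w y + d)}"

text \<open>For \<open>\<omega> = (\<lambda>y. w y + d)\<close> with \<open>w\<close> linear, \<open>\<lambda>y. \<omega> y - \<omega> 0\<close> is \<open>w\<close>.\<close>

definition weyl_sign :: "(real^'n \<Rightarrow> real^'n) \<Rightarrow> real" where
  "weyl_sign \<omega> = det (matrix (\<lambda>y. \<omega> y - \<omega> 0))"

definition alcove :: "(real^'n::{finite,linorder}) set" where
  "alcove = {y. 1 + y $ Max UNIV > y $ Min UNIV \<and> (\<forall>i j. i < j \<longrightarrow> y $ i > y $ j)}"

definition pair_partitions :: "'n set \<Rightarrow> 'n set set set" where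
  "pair_partitions A = {\<pi>. partition_on A \<pi> \<and> (\<forall>B\<in>\<pi>. card B = 2)}"

text \<open>
  The two blocks of a crossing are distinguished by \<open>i < i'\<close>, so each crossing pair is counted
  once.
\<close>

definition crossings :: "'n::linorder set set \<Rightarrow> nat" where
  "crossings \<pi> = card {({i, j}, {i', j'}) | i j i' j'.
     {i, j} \<in> \<pi> \<and> {i', j'} \<in> \<pi> \<and> i < i' \<and> i' < j \<and> j < j'}"

definition pfaffian :: "'n::linorder set \<Rightarrow> ('n \<Rightarrow> 'n \<Rightarrow> 'a::comm_ring_1) \<Rightarrow> 'a" where
  "pfaffian A a =
     (\<Sum>\<pi>\<in>pair_partitions A. (-1) ^ crossings \<pi> * (\<Prod>B\<in>\<pi>. a (Min B) (Max B)))"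

definition tensor :: "('n \<Rightarrow> real \<Rightarrow> real) \<Rightarrow> real^'n::finite \<Rightarrow> real" where
  "tensor f y = (\<Prod>i\<in>UNIV. f i (y $ i))"

definition J_integrand :: "('n \<Rightarrow> real \<Rightarrow> real) \<Rightarrow> 'n \<Rightarrow> 'n \<Rightarrow> real \<times> real \<Rightarrow> real" where
  "J_integrand f i j = (\<lambda>(y, z). (-1) powi \<lfloor>y - z\<rfloor> * f i y * f j z)"

definition J :: "('n \<Rightarrow> real \<Rightarrow> real) \<Rightarrow> 'n \<Rightarrow> 'n \<Rightarrow> real" where
  "J f i j = (LINT p|lebesgue. J_integrand f i j p)"

end

theory Submission
  imports Defs
begin

text \<open>
  Put \<open>g x = Pf ((-1)^\<lfloor>x\<^sub>i - x\<^sub>j\<rfloor>)\<close>. Translating \<open>x\<close> by \<open>d \<in> L\<close> multiplies the \<open>(i, j)\<close> entry by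
  \<open>(-1)^(d\<^sub>i + d\<^sub>j)\<close>, hence \<open>g\<close> by \<open>(-1)^(\<Sum>i. d\<^sub>i) = 1\<close>; permuting coordinates multiplies \<open>g\<close> by
  the signature; and on the alcove all entries above the diagonal are \<open>1\<close>, where the Pfaffian is
  the signed number of pair partitions, namely \<open>1\<close>. So \<open>\<epsilon>(\<omega>) = g(\<omega> y)\<close> for \<open>y\<close> in the alcove, and
  since the alcove is a fundamental domain the left-hand side unfolds to the integral of \<open>g f\<close> over
  the whole space, which Fubini splits block by block into the Pfaffian of the \<open>J i j\<close>.
\<close>

section \<open>Crossings and signs\<close>

text \<open>Crossings refer to the order of the indices, which a permutation destroys. The remedy is
  to write \<open>(- 1) ^ crossings \<pi>\<close> as a product of order signs over pairs from
  different blocks: with the pairs inside the blocks, these are all pairs of indices, and there the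
  effect of a permutation is its signature. Only matrices of order signs have to be treated, because
  these are what remains of the floor signs once the translation is removed.

  The fundamental domain property can fail on the walls, where some difference of coordinates is an
  integer, so it is used as an equality of measures: counting measure on the group times Lebesgue
  measure on the alcove is pushed forward to Lebesgue measure. Fubini on this product also yields
  summability of almost every orbit sum, which matters because a divergent sum has a default value.

  The \<open>f i\<close> are only Lebesgue measurable. The computation is done for Borel
  representatives; since the group is countable and preserves measure, changing representatives
  alters the orbit sums only on a null set.\<close>

text \<open>Each relation selects exactly one of \<open>(x, y)\<close> and \<open>(y, x)\<close>,
  and a symmetric \<open>F\<close> does not see which. This is used to exchange an order coming from
  a permutation or from blocks for a more convenient one.\<close>

lemma prod_orientation:
  fixes F :: "'a \<Rightarrow> 'a \<Rightarrow> 'b::comm_monoid_mult"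
  assumes sym: "\<And>x y. x \<in> X \<Longrightarrow> y \<in> X \<Longrightarrow> x \<noteq> y \<Longrightarrow> F x y = F y x"
    and R: "\<And>x y. x \<in> X \<Longrightarrow> y \<in> X \<Longrightarrow> x \<noteq> y \<Longrightarrow> R x y \<longleftrightarrow> \<not> R y x"
    and R': "\<And>x y. x \<in> X \<Longrightarrow> y \<in> X \<Longrightarrow> x \<noteq> y \<Longrightarrow> R' x y \<longleftrightarrow> \<not> R' y x"
  shows "(\<Prod>(x, y)\<in>{(x, y). x \<in> X \<and> y \<in> X \<and> x \<noteq> y \<and> R x y}. F x y) =
         (\<Prod>(x, y)\<in>{(x, y). x \<in> X \<and> y \<in> X \<and> x \<noteq> y \<and> R' x y}. F x y)"
proof (rule prod.reindex_bij_witness[where i = "\<lambda>(x, y). if R x y then (x, y) else (y, x)"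
      and j = "\<lambda>(x, y). if R' x y then (x, y) else (y, x)"])
  fix a assume "a \<in> {(x, y). x \<in> X \<and> y \<in> X \<and> x \<noteq> y \<and> R x y}"
  then obtain x y where a: "a = (x, y)" "x \<in> X" "y \<in> X" "x \<noteq> y" "R x y" by auto
  show "(case case a of (x, y) \<Rightarrow> if R' x y then (x, y) else (y, x) of
      (x, y) \<Rightarrow> if R x y then (x, y) else (y, x)) = a"
    and "(case a of (x, y) \<Rightarrow> if R' x y then (x, y) else (y, x)) \<in>
      {(x, y). x \<in> X \<and> y \<in> X \<and> x \<noteq> y \<and> R' x y}"
    and "(case case a of (x, y) \<Rightarrow> if R' x y then (x, y) else (y, x) of (x, y) \<Rightarrow> F x y) =
      (case a of (x, y) \<Rightarrow> F x y)"
    using a R[of x y] R'[of x y] sym[of x y] by auto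
next
  fix b assume "b \<in> {(x, y). x \<in> X \<and> y \<in> X \<and> x \<noteq> y \<and> R' x y}"
  then obtain x y where b: "b = (x, y)" "x \<in> X" "y \<in> X" "x \<noteq> y" "R' x y" by auto
  show "(case case b of (x, y) \<Rightarrow> if R x y then (x, y) else (y, x) of
      (x, y) \<Rightarrow> if R' x y then (x, y) else (y, x)) = b"
    and "(case b of (x, y) \<Rightarrow> if R x y then (x, y) else (y, x)) \<in>
      {(x, y). x \<in> X \<and> y \<in> X \<and> x \<noteq> y \<and> R x y}"
    using b R[of x y] R'[of x y] by auto
qed

text \<open>For \<open>u \<noteq> v\<close> this is the floor sign of \<open>y $ u - y $ v\<close>
  at a point \<open>y\<close> of the alcove, where coordinates decrease and differ by less than
  1.\<close>

definition order_sign :: "'a::linorder \<Rightarrow> 'a \<Rightarrow> int" where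
  "order_sign u v = (if v < u then - 1 else 1)"

lemma order_sign_swap: "u \<noteq> v \<Longrightarrow> order_sign v u = - order_sign u v"
  by (auto simp: order_sign_def)

lemma order_sign_square [simp]: "order_sign u v * order_sign u v = 1"
  by (auto simp: order_sign_def)

lemma prod_order_sign_increasing:
  "(\<Prod>(i, j)\<in>{(i, j). i \<in> A \<and> j \<in> A \<and> i < j}. order_sign i j) = 1"
  by (rule prod.neutral) (auto simp: order_sign_def)

text \<open>The inverted pairs are \<open>(a, b)\<close> and, for each \<open>m\<close> strictly
  between, \<open>(a, m)\<close> and \<open>(m, b)\<close>: an odd number.\<close>

lemma prod_order_sign_transpose:
  assumes "finite A" "a \<in> A" "b \<in> A" "a < b"
  shows "(\<Prod>(i, j)\<in>{(i, j). i \<in> A \<and> j \<in> A \<and> i < j}.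
            order_sign (Transposition.transpose a b i) (Transposition.transpose a b j)) = - 1"
proof -
  let ?t = "Transposition.transpose a b"
  let ?P = "{(i, j). i \<in> A \<and> j \<in> A \<and> i < j}"
  let ?M = "{m \<in> A. a < m \<and> m < b}"
  let ?N = "{p \<in> ?P. ?t (snd p) < ?t (fst p)}"
  have finP: "finite ?P"
    by (rule finite_subset[of _ "A \<times> A"]) (use assms in auto)
  have N: "?N = insert (a, b) (Pair a ` ?M \<union> (\<lambda>m. (m, b)) ` ?M)"
    using assms by (auto simp: Transposition.transpose_def split: if_splits)
  have "card ?N = Suc (card (Pair a ` ?M \<union> (\<lambda>m. (m, b)) ` ?M))"
    unfolding N using assms by (subst card_insert_disjoint) auto
  also have "card (Pair a ` ?M \<union> (\<lambda>m. (m, b)) ` ?M) = card ?M + card ?M"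
    using assms by (subst card_Un_disjoint) (auto simp: card_image inj_on_def)
  finally have N_odd: "odd (card ?N)" by simp
  have "(\<Prod>(i, j)\<in>?P. order_sign (?t i) (?t j)) =
        (\<Prod>p\<in>?P. if ?t (snd p) < ?t (fst p) then - 1 else 1)"
    by (simp add: order_sign_def case_prod_unfold)
  also have "\<dots> = (\<Prod>p\<in>?N. - 1) * (\<Prod>p\<in>?P \<inter> - {p. ?t (snd p) < ?t (fst p)}. 1)"
    using finP by (simp add: prod.If_cases Int_def)
  also have "\<dots> = (- 1) ^ card ?N"
    by simp
  finally show ?thesis using N_odd by simp
qed

text \<open>Signature by inversions. When a transposition \<open>t\<close> is appended to
  \<open>p\<close>, the order sign of the images under \<open>p\<close> is compared with that of its
  arguments: the product \<open>?F\<close> of the two is symmetric, as both factors change sign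
  together, so the pairs permuted by \<open>t\<close> may be reoriented, and only the inversions of
  \<open>t\<close> itself are left over.\<close>

lemma prod_order_sign_permutes:
  assumes "finite A" "\<sigma> permutes A"
  shows "(\<Prod>(i, j)\<in>{(i, j). i \<in> A \<and> j \<in> A \<and> i < j}. order_sign (\<sigma> i) (\<sigma> j)) = sign \<sigma>"
  using assms
proof (induction rule: permutes_rev_induct)
  case id
  then show ?case by (simp add: prod_order_sign_increasing)
next
  case (swap a b p)
  let ?t = "Transposition.transpose a b"
  let ?P = "{(i, j). i \<in> A \<and> j \<in> A \<and> i < j}"
  let ?F = "\<lambda>u v. order_sign (p u) (p v) * order_sign u v"
  have t: "?t permutes A" using swap by (simp add: permutes_swap_id)
  have sign_t: "(\<Prod>(i, j)\<in>?P. order_sign (?t i) (?t j)) = - 1"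
  proof (cases "a < b")
    case True
    then show ?thesis using swap assms by (intro prod_order_sign_transpose) auto
  next
    case False
    then show ?thesis using swap assms prod_order_sign_transpose[of A b a]
      by (simp add: Transposition.transpose_commute)
  qed
  have "(\<Prod>(i, j)\<in>?P. order_sign ((p \<circ> ?t) i) ((p \<circ> ?t) j)) =
        (\<Prod>(i, j)\<in>?P. ?F (?t i) (?t j)) * (\<Prod>(i, j)\<in>?P. order_sign (?t i) (?t j))"
    by (simp add: prod.distrib[symmetric] case_prod_unfold mult.assoc)
  also have "(\<Prod>(i, j)\<in>?P. ?F (?t i) (?t j)) =
      (\<Prod>(u, v)\<in>{(u, v). u \<in> A \<and> v \<in> A \<and> u \<noteq> v \<and> ?t u < ?t v}. ?F u v)"
    using permutes_in_image[OF t]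
    by (intro prod.reindex_bij_witness[where i = "\<lambda>(u, v). (?t u, ?t v)"
          and j = "\<lambda>(u, v). (?t u, ?t v)"]) (auto simp: inj_eq[OF permutes_inj[OF t]])
  also have "\<dots> = (\<Prod>(u, v)\<in>{(u, v). u \<in> A \<and> v \<in> A \<and> u \<noteq> v \<and> u < v}. ?F u v)"
  proof (rule prod_orientation)
    fix u v assume uv: "u \<in> A" "v \<in> A" "u \<noteq> v"
    then have "p u \<noteq> p v" "?t u \<noteq> ?t v"
      by (simp_all add: inj_eq[OF permutes_inj[OF \<open>p permutes A\<close>]] inj_eq[OF permutes_inj[OF t]])
    then show "?F u v = ?F v u"
      using order_sign_swap[OF \<open>u \<noteq> v\<close>] order_sign_swap[of "p u" "p v"] by simp
    show "(?t u < ?t v) = (\<not> ?t v < ?t u)"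
      using \<open>?t u \<noteq> ?t v\<close> by (simp only: not_less_iff_gr_or_eq) simp
  qed (simp only: not_less_iff_gr_or_eq, simp)
  also have "{(u, v). u \<in> A \<and> v \<in> A \<and> u \<noteq> v \<and> u < v} = ?P" by auto
  also have "(\<Prod>(u, v)\<in>?P. ?F u v) = sign p"
    using swap.IH prod_order_sign_increasing[of A] by (simp add: case_prod_unfold prod.distrib)
  also have "(\<Prod>(i, j)\<in>?P. order_sign (?t i) (?t j)) = - 1" by (fact sign_t)
  also have "sign p * - 1 = sign (p \<circ> ?t)"
    using swap permutation_permutes[of p] assms(1)
    by (subst sign_compose) (auto simp: sign_swap_id permutation_swap_id)
  finally show ?case .
qed

section \<open>Pair partitions and the sign of their crossings\<close>

lemma pair_partitionsD:
  assumes "\<pi> \<in> pair_partitions A"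
  shows "partition_on A \<pi>" "\<And>B. B \<in> \<pi> \<Longrightarrow> card B = 2" "\<And>B. B \<in> \<pi> \<Longrightarrow> finite B"
    "\<And>B. B \<in> \<pi> \<Longrightarrow> B \<noteq> {}" "\<And>B. B \<in> \<pi> \<Longrightarrow> B \<subseteq> A" "\<Union>\<pi> = A"
    "\<And>B C. B \<in> \<pi> \<Longrightarrow> C \<in> \<pi> \<Longrightarrow> B \<noteq> C \<Longrightarrow> B \<inter> C = {}"
proof -
  show *: "partition_on A \<pi>" "\<And>B. B \<in> \<pi> \<Longrightarrow> card B = 2"
    using assms by (auto simp: pair_partitions_def)
  then show "\<Union>\<pi> = A" "\<And>B. B \<in> \<pi> \<Longrightarrow> B \<subseteq> A"
    by (auto simp: partition_on_def)
  show "\<And>B C. B \<in> \<pi> \<Longrightarrow> C \<in> \<pi> \<Longrightarrow> B \<noteq> C \<Longrightarrow> B \<inter> C = {}"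
    using * by (auto simp: partition_on_def disjoint_def)
  show "\<And>B. B \<in> \<pi> \<Longrightarrow> finite B"
    using *(2) by (metis card.infinite zero_neq_numeral)
  show "\<And>B. B \<in> \<pi> \<Longrightarrow> B \<noteq> {}"
    using *(2) by force
qed

lemma finite_pair_partitions: "finite A \<Longrightarrow> finite (pair_partitions A)"
  by (rule finite_subset[of _ "Pow (Pow A)"]) (auto dest: pair_partitionsD(5))

lemma finite_pair_partition: "finite A \<Longrightarrow> \<pi> \<in> pair_partitions A \<Longrightarrow> finite \<pi>"
  using finite_elements pair_partitionsD(1) by blast

lemma card_2_Min_Max:
  fixes B :: "'a::linorder set"
  assumes "card B = 2"
  shows "B = {Min B, Max B}" "Min B < Max B"
proof -
  obtain x y where "B = {x, y}" "x \<noteq> y" using assms by (auto simp: card_2_iff)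
  then show "B = {Min B, Max B}" "Min B < Max B"
    by (cases x y rule: linorder_cases; auto simp: min_def max_def)+
qed

text \<open>The orientation by minima is the one in \<open>crossings\<close>, so every crossing is a
  single element of this set.\<close>

definition ordered_blocks :: "'a::linorder set set \<Rightarrow> ('a set \<times> 'a set) set" where
  "ordered_blocks \<pi> = {(B, C). B \<in> \<pi> \<and> C \<in> \<pi> \<and> B \<noteq> C \<and> Min B < Min C}"

lemma finite_ordered_blocks: "finite \<pi> \<Longrightarrow> finite (ordered_blocks \<pi>)"
  by (rule finite_subset[of _ "\<pi> \<times> \<pi>"]) (auto simp: ordered_blocks_def)

lemma block_Min_neq:
  assumes "\<pi> \<in> pair_partitions A" "B \<in> \<pi>" "C \<in> \<pi>" "B \<noteq> C"
  shows "Min B \<noteq> Min C" "Min B \<noteq> Max C" "Max B \<noteq> Max C"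
proof -
  have "B \<inter> C = {}" using pair_partitionsD(7)[OF assms] .
  moreover have "Min B \<in> B" "Max B \<in> B" "Min C \<in> C" "Max C \<in> C"
    using pair_partitionsD(3,4)[OF assms(1)] assms(2,3) by auto
  ultimately show "Min B \<noteq> Min C" "Min B \<noteq> Max C" "Max B \<noteq> Max C" by force+
qed

text \<open>Two blocks cross iff an odd number of the four pairs between them are out of order.\<close>

lemma crossings_sign:
  fixes A :: "'a::linorder set"
  assumes "finite A" "\<pi> \<in> pair_partitions A"
  shows "(-1) ^ crossings \<pi> =
    (\<Prod>(B, C)\<in>ordered_blocks \<pi>. \<Prod>u\<in>B. \<Prod>v\<in>C. order_sign u v)"
proof -
  note D = pair_partitionsD[OF assms(2)]
  let ?cross = "\<lambda>(B, C). Min C < Max B \<and> Max B < Max (C :: 'a set)"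
  have eq: "{({i, j}, {i', j'}) | i j i' j'. {i, j} \<in> \<pi> \<and> {i', j'} \<in> \<pi> \<and> i < i' \<and> i' < j \<and> j < j'} =
      {p \<in> ordered_blocks \<pi>. ?cross p}" (is "?L = ?R")
  proof (intro equalityI subsetI)
    fix p assume "p \<in> ?L"
    then obtain i j i' j' where p: "p = ({i, j}, {i', j'})" "{i, j} \<in> \<pi>" "{i', j'} \<in> \<pi>"
      and o: "i < i'" "i' < j" "j < j'" by auto
    then have "i < j" "i' < j'" by auto
    then have "Min {i, j} = i" "Max {i, j} = j" "Min {i', j'} = i'" "Max {i', j'} = j'"
      by auto
    then show "p \<in> ?R" using p o by (auto simp: ordered_blocks_def doubleton_eq_iff)
  next
    fix p assume "p \<in> ?R"
    then obtain B C where p: "p = (B, C)" "B \<in> \<pi>" "C \<in> \<pi>"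
      and o: "Min B < Min C" "Min C < Max B" "Max B < Max C"
      by (auto simp: ordered_blocks_def)
    have "B = {Min B, Max B}" "C = {Min C, Max C}"
      using p D(2) card_2_Min_Max(1) by blast+
    then show "p \<in> ?L" using p o by auto metis
  qed
  have "(\<Prod>(B, C)\<in>ordered_blocks \<pi>. \<Prod>u\<in>B. \<Prod>v\<in>C. order_sign u v) =
        (\<Prod>p\<in>ordered_blocks \<pi>. if ?cross p then - 1 else 1)"
  proof (rule prod.cong[OF refl])
    fix p assume "p \<in> ordered_blocks \<pi>"
    then obtain B C where p: "p = (B, C)" and "(B, C) \<in> ordered_blocks \<pi>" by (cases p) auto
    then have *: "B \<in> \<pi>" "C \<in> \<pi>" "B \<noteq> C" "Min B < Min C" by (auto simp: ordered_blocks_def)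
    note B = card_2_Min_Max[OF D(2)[OF *(1)]] and C = card_2_Min_Max[OF D(2)[OF *(2)]]
    note neq = block_Min_neq[OF assms(2) *(1,2,3)] block_Min_neq[OF assms(2) *(2,1) *(3)[symmetric]]
    have "(\<Prod>u\<in>B. \<Prod>v\<in>C. order_sign u v) =
      (\<Prod>u\<in>{Min B, Max B}. \<Prod>v\<in>{Min C, Max C}. order_sign u v)"
      using B(1) C(1) by simp
    also have "\<dots> = order_sign (Min B) (Min C) * order_sign (Min B) (Max C) *
      (order_sign (Max B) (Min C) * order_sign (Max B) (Max C))"
      using B(2) C(2) by simp
    \<comment> \<open>\<open>Min B\<close> lies below both elements of \<open>C\<close>, so only
      \<open>Max B\<close> matters. If it exceeds \<open>Max C\<close>, it exceeds
      \<open>Min C\<close> too and two signs cancel; a single inversion remains exactly for a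
      crossing.\<close>
    also have "\<dots> = (if ?cross (B, C) then - 1 else 1)"
      using *(4) B(2) C(2) neq by (auto simp: order_sign_def)
    finally show "(case p of (B, C) \<Rightarrow> \<Prod>u\<in>B. \<Prod>v\<in>C. order_sign u v) =
      (if ?cross p then - 1 else 1)"
      by (simp add: p)
  qed
  also have "\<dots> = (\<Prod>p\<in>{p \<in> ordered_blocks \<pi>. ?cross p}. - 1) *
      (\<Prod>p\<in>ordered_blocks \<pi> \<inter> - {p. ?cross p}. 1)"
    using finite_ordered_blocks[OF finite_pair_partition[OF assms]]
    by (simp add: prod.If_cases Int_def)
  also have "\<dots> = (- 1) ^ card {p \<in> ordered_blocks \<pi>. ?cross p}"
    by simp
  finally show ?thesis by (simp add: crossings_def eq)
qed

text \<open>Separates the pairs inside blocks, which give the entries of a Pfaffian, from the pairs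
  between blocks, which give the crossings.\<close>

lemma prod_pairs_by_blocks:
  fixes F :: "'a::linorder \<Rightarrow> 'a \<Rightarrow> 'b::comm_monoid_mult"
  assumes "finite A" "\<pi> \<in> pair_partitions A"
    and sym: "\<And>x y. x \<in> A \<Longrightarrow> y \<in> A \<Longrightarrow> x \<noteq> y \<Longrightarrow> F x y = F y x"
  shows "(\<Prod>(i, j)\<in>{(i, j). i \<in> A \<and> j \<in> A \<and> i < j}. F i j) =
    (\<Prod>B\<in>\<pi>. F (Min B) (Max B)) * (\<Prod>(B, C)\<in>ordered_blocks \<pi>. \<Prod>u\<in>B. \<Prod>v\<in>C. F u v)"
proof -
  note D = pair_partitionsD[OF assms(2)]
  have fin: "finite \<pi>" by (rule finite_pair_partition[OF assms(1,2)])
  have "\<forall>u\<in>A. \<exists>B. B \<in> \<pi> \<and> u \<in> B"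
    using D(6) by blast
  then obtain blk where blk: "\<And>u. u \<in> A \<Longrightarrow> blk u \<in> \<pi> \<and> u \<in> blk u"
    unfolding bchoice_iff by blast
  have blk_eq: "blk u = B" if "u \<in> B" "B \<in> \<pi>" for u B
    using blk[of u] that D(5,7) by blast
  \<comment> \<open>Elements of one block are compared directly, elements of different blocks
    through the minima of the blocks. Symmetry of \<open>F\<close> makes this as good as the order
    of the elements.\<close>
  let ?R = "\<lambda>u v. if blk u = blk v then u < v else Min (blk u) < Min (blk v)"
  let ?S1 = "(\<lambda>B. (Min B, Max B)) ` \<pi>" and ?S2 = "\<Union>p\<in>ordered_blocks \<pi>. fst p \<times> snd p"
  have MM: "Min B \<in> B" "Max B \<in> B" "Min B < Max B" "B = {Min B, Max B}" if "B \<in> \<pi>" for B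
    using Min_in[of B] Max_in[of B] that D(3,4) card_2_Min_Max[OF D(2)[OF that]] by blast+
  have "{(i, j). i \<in> A \<and> j \<in> A \<and> i < j} = {(i, j). i \<in> A \<and> j \<in> A \<and> i \<noteq> j \<and> i < j}" by auto
  then have "(\<Prod>(i, j)\<in>{(i, j). i \<in> A \<and> j \<in> A \<and> i < j}. F i j) =
      (\<Prod>(i, j)\<in>{(i, j). i \<in> A \<and> j \<in> A \<and> i \<noteq> j \<and> i < j}. F i j)" by simp
  also have "\<dots> = (\<Prod>(i, j)\<in>{(i, j). i \<in> A \<and> j \<in> A \<and> i \<noteq> j \<and> ?R i j}. F i j)"
  proof (rule prod_orientation)
    fix x y assume xy: "x \<in> A" "y \<in> A" "x \<noteq> y"
    then show "?R x y = (\<not> ?R y x)"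
      using block_Min_neq(1)[OF assms(2), of "blk x" "blk y"] blk
      by (simp only: not_less_iff_gr_or_eq split: if_splits) metis
  qed (use sym in auto)
  also have "{(i, j). i \<in> A \<and> j \<in> A \<and> i \<noteq> j \<and> ?R i j} = ?S1 \<union> ?S2"
  proof (intro equalityI subsetI)
    fix p assume "p \<in> {(i, j). i \<in> A \<and> j \<in> A \<and> i \<noteq> j \<and> ?R i j}"
    then obtain i j where p: "p = (i, j)" "i \<in> A" "j \<in> A" "i \<noteq> j" "?R i j" by auto
    show "p \<in> ?S1 \<union> ?S2"
    proof (cases "blk i = blk j")
      case True
      then have "i < j" "i \<in> blk i" "j \<in> blk i" "blk i \<in> \<pi>" using p blk[of i] blk[of j] by auto
      moreover from this have "i = Min (blk i)" "j = Max (blk i)"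
        using MM[of "blk i"] by (metis insert_iff less_asym singletonD)+
      ultimately show ?thesis using p by blast
    next
      case False
      then have "(blk i, blk j) \<in> ordered_blocks \<pi>"
        using p blk[of i] blk[of j] by (auto simp: ordered_blocks_def)
      then show ?thesis using p blk[of i] blk[of j] by force
    qed
  next
    fix p assume "p \<in> ?S1 \<union> ?S2"
    then consider B where "B \<in> \<pi>" "p = (Min B, Max B)"
      | B C i j where "(B, C) \<in> ordered_blocks \<pi>" "p = (i, j)" "i \<in> B" "j \<in> C" by auto
    then show "p \<in> {(i, j). i \<in> A \<and> j \<in> A \<and> i \<noteq> j \<and> ?R i j}"
    proof cases
      case 1
      then show ?thesis using MM[of B] D(5)[of B] blk_eq[of "Min B" B] blk_eq[of "Max B" B] by auto
    next
      case 2
      then show ?thesis using blk_eq[of i B] blk_eq[of j C] D(5)[of B] D(5)[of C] D(7)[of B C]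
        by (auto simp: ordered_blocks_def)
    qed
  qed
  also have "(\<Prod>(i, j)\<in>?S1 \<union> ?S2. F i j) = (\<Prod>(i, j)\<in>?S1. F i j) * (\<Prod>(i, j)\<in>?S2. F i j)"
  proof (rule prod.union_disjoint)
    show "finite ?S1" using fin by auto
    show "finite ?S2" using finite_ordered_blocks[OF fin] D(3) by (auto simp: ordered_blocks_def)
    have "(Min B, Max B) \<notin> C \<times> D" if "B \<in> \<pi>" "(C, D) \<in> ordered_blocks \<pi>" for B C D
      using that MM(1,2)[of B] D(7)[of B C] D(7)[of B D] by (auto simp: ordered_blocks_def)
    then show "?S1 \<inter> ?S2 = {}" by fastforce
  qed
  also have "(\<Prod>(i, j)\<in>?S1. F i j) = (\<Prod>B\<in>\<pi>. F (Min B) (Max B))"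
  proof (subst prod.reindex)
    show "inj_on (\<lambda>B. (Min B, Max B)) \<pi>" by (rule inj_onI) (metis MM(4) prod.inject)
  qed auto
  also have "(\<Prod>(i, j)\<in>?S2. F i j) = (\<Prod>p\<in>ordered_blocks \<pi>. \<Prod>(i, j)\<in>fst p \<times> snd p. F i j)"
  proof (rule prod.UNION_disjoint[OF finite_ordered_blocks[OF fin]])
    show "\<forall>p\<in>ordered_blocks \<pi>. finite (fst p \<times> snd p)"
      using D(3) by (auto simp: ordered_blocks_def)
    show "\<forall>p\<in>ordered_blocks \<pi>. \<forall>q\<in>ordered_blocks \<pi>. p \<noteq> q \<longrightarrow> fst p \<times> snd p \<inter> fst q \<times> snd q = {}"
      using D(7) by (fastforce simp: ordered_blocks_def)
  qed
  also have "\<dots> = (\<Prod>(B, C)\<in>ordered_blocks \<pi>. \<Prod>u\<in>B. \<Prod>v\<in>C. F u v)"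
    by (rule prod.cong) (auto simp: prod.cartesian_product)
  finally show ?thesis .
qed

section \<open>The action of permutations on pair partitions\<close>

lemma image_pair_partitions:
  assumes "\<sigma> permutes A" "\<pi> \<in> pair_partitions A"
  shows "image \<sigma> ` \<pi> \<in> pair_partitions A"
proof -
  note D = pair_partitionsD[OF assms(2)]
  have inj: "inj \<sigma>" using assms(1) by (rule permutes_inj)
  have "partition_on A (image \<sigma> ` \<pi>)"
    unfolding partition_on_def disjoint_def
  proof (intro conjI ballI impI)
    show "\<Union> (image \<sigma> ` \<pi>) = A"
      using D(6) permutes_image[OF assms(1)] by blast
    show "B \<inter> C = {}" if "B \<in> image \<sigma> ` \<pi>" "C \<in> image \<sigma> ` \<pi>" "B \<noteq> C" for B C
      using that D(7) inj by (auto dest: injD)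
    show "{} \<notin> image \<sigma> ` \<pi>" using D(4) by auto
  qed
  moreover have "card B = 2" if "B \<in> image \<sigma> ` \<pi>" for B
    using that D(2) inj by (auto simp: card_image inj_on_subset)
  ultimately show ?thesis by (simp add: pair_partitions_def)
qed

lemma bij_betw_image_pair_partitions:
  assumes "\<sigma> permutes A"
  shows "bij_betw (image (image \<sigma>)) (pair_partitions A) (pair_partitions A)"
proof (rule bij_betwI[where g = "image (image (inv \<sigma>))"])
  show "image (image \<sigma>) \<in> pair_partitions A \<rightarrow> pair_partitions A"
    "image (image (inv \<sigma>)) \<in> pair_partitions A \<rightarrow> pair_partitions A"
    using image_pair_partitions assms permutes_inv by blast+
qed (simp_all add: image_image permutes_inverses[OF assms])

text \<open>The inversion formula for \<open>sign \<sigma>\<close> is split along the blocks of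
  \<open>\<pi>\<close>. Pairs between blocks give the crossing signs of \<open>\<pi>\<close> and of
  its image, pairs inside blocks give the remaining product.\<close>

lemma crossings_image_sign:
  assumes "finite A" "\<sigma> permutes A" "\<pi> \<in> pair_partitions A"
  shows "(- 1) ^ crossings (image \<sigma> ` \<pi>) =
    (- 1) ^ crossings \<pi> * (sign \<sigma> * (\<Prod>B\<in>\<pi>. order_sign (\<sigma> (Min B)) (\<sigma> (Max B))))"
proof -
  note D = pair_partitionsD[OF assms(3)]
  note D' = pair_partitionsD[OF image_pair_partitions[OF assms(2,3)]]
  have inj: "inj \<sigma>" using assms(2) by (rule permutes_inj)
  let ?F = "\<lambda>u v. order_sign (\<sigma> u) (\<sigma> v) * order_sign u v"
  let ?G = "\<lambda>B C. \<Prod>u\<in>B. \<Prod>v\<in>C. order_sign u v"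
  let ?P = "\<Prod>B\<in>\<pi>. order_sign (\<sigma> (Min B)) (\<sigma> (Max B))"
  \<comment> \<open>Exchanging two blocks reverses four pairs, an even number. This is needed
    because \<open>\<sigma>\<close> may change the order of the minima of blocks.\<close>
  have G_sym: "?G B C = ?G C B"
    if BC: "B \<in> image \<sigma> ` \<pi>" "C \<in> image \<sigma> ` \<pi>" "B \<noteq> C" for B C
  proof -
    have "?G B C = (\<Prod>u\<in>B. \<Prod>v\<in>C. - order_sign v u)"
      using D'(7)[OF BC] by (intro prod.cong refl order_sign_swap) auto
    also have "\<dots> = (\<Prod>u\<in>B. \<Prod>v\<in>C. order_sign v u)"
      using D'(2)[OF BC(2)] by (simp add: prod_uminus)
    also have "\<dots> = ?G C B" by (rule prod.swap)
    finally show ?thesis .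
  qed
  have Min_image: "B = C" if "B \<in> \<pi>" "C \<in> \<pi>" "Min B = Min C" for B C
    using block_Min_neq(1)[OF assms(3)] that by blast
  have "sign \<sigma> = (\<Prod>(i, j)\<in>{(i, j). i \<in> A \<and> j \<in> A \<and> i < j}. ?F i j)"
    using prod_order_sign_permutes[OF assms(1,2)] prod_order_sign_increasing[of A]
    by (simp add: case_prod_unfold prod.distrib)
  also have "\<dots> = (\<Prod>B\<in>\<pi>. ?F (Min B) (Max B)) *
      (\<Prod>(B, C)\<in>ordered_blocks \<pi>. \<Prod>u\<in>B. \<Prod>v\<in>C. ?F u v)"
  proof (rule prod_pairs_by_blocks[OF assms(1,3)])
    fix x y :: 'a assume "x \<noteq> y"
    then have "\<sigma> x \<noteq> \<sigma> y" using inj by (auto dest: injD)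
    then show "?F x y = ?F y x"
      using order_sign_swap[OF \<open>x \<noteq> y\<close>] order_sign_swap[of "\<sigma> x" "\<sigma> y"] by simp
  qed
  also have "(\<Prod>B\<in>\<pi>. ?F (Min B) (Max B)) = ?P"
    using card_2_Min_Max(2)[OF D(2)]
    by (intro prod.cong refl) (simp add: order_sign_def not_less_iff_gr_or_eq)
  also have "(\<Prod>(B, C)\<in>ordered_blocks \<pi>. \<Prod>u\<in>B. \<Prod>v\<in>C. ?F u v) =
      (\<Prod>(B, C)\<in>ordered_blocks \<pi>. ?G (\<sigma> ` B) (\<sigma> ` C)) * (\<Prod>(B, C)\<in>ordered_blocks \<pi>. ?G B C)"
    using inj by (simp add: case_prod_unfold prod.distrib prod.reindex inj_on_subset[OF inj])
  also have "(\<Prod>(B, C)\<in>ordered_blocks \<pi>. ?G B C) = (- 1) ^ crossings \<pi>"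
    using crossings_sign[OF assms(1,3)] by simp
  also have "(\<Prod>(B, C)\<in>ordered_blocks \<pi>. ?G (\<sigma> ` B) (\<sigma> ` C)) =
      (\<Prod>(B, C)\<in>{(B, C). B \<in> image \<sigma> ` \<pi> \<and> C \<in> image \<sigma> ` \<pi> \<and> B \<noteq> C \<and>
         Min (\<sigma> -` B) < Min (\<sigma> -` C)}. ?G B C)"
    by (rule prod.reindex_bij_witness[where i = "\<lambda>(B, C). (\<sigma> -` B, \<sigma> -` C)"
          and j = "\<lambda>(B, C). (\<sigma> ` B, \<sigma> ` C)"])
      (auto simp: ordered_blocks_def inj_vimage_image_eq[OF inj] inj_image_eq_iff[OF inj] inj_eq[OF inj])
  \<comment> \<open>After the reindexing, the image blocks are still ordered by the minima of their
    preimages; by \<open>G_sym\<close> they may be ordered by their own.\<close>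
  also have "\<dots> = (\<Prod>(B, C)\<in>{(B, C). B \<in> image \<sigma> ` \<pi> \<and> C \<in> image \<sigma> ` \<pi> \<and> B \<noteq> C \<and>
         Min B < Min C}. ?G B C)"
  proof (rule prod_orientation)
    fix B C assume BC: "B \<in> image \<sigma> ` \<pi>" "C \<in> image \<sigma> ` \<pi>" "B \<noteq> C"
    show "?G B C = ?G C B" by (rule G_sym[OF BC])
    have "Min B \<noteq> Min C"
      by (rule block_Min_neq(1)[OF image_pair_partitions[OF assms(2,3)] BC])
    then show "(Min B < Min C) = (\<not> Min C < Min B)" by (simp only: not_less_iff_gr_or_eq) simp
    have "Min (\<sigma> -` B) \<noteq> Min (\<sigma> -` C)"
      using BC Min_image by (metis image_iff inj_vimage_image_eq[OF inj])
    then show "(Min (\<sigma> -` B) < Min (\<sigma> -` C)) = (\<not> Min (\<sigma> -` C) < Min (\<sigma> -` B))"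
      by (simp only: not_less_iff_gr_or_eq) simp
  qed
  also have "\<dots> = (- 1) ^ crossings (image \<sigma> ` \<pi>)"
    using crossings_sign[OF assms(1) image_pair_partitions[OF assms(2,3)]]
    by (simp add: ordered_blocks_def)
  finally have sign: "sign \<sigma> = ?P * ((- 1) ^ crossings (image \<sigma> ` \<pi>) * (- 1) ^ crossings \<pi>)" .
  have PP: "?P * ?P = 1" by (simp add: prod.distrib[symmetric])
  have cc: "(- 1) ^ n * (- 1) ^ n = (1 :: int)" for n
    by (simp add: power_add[symmetric])
  \<comment> \<open>All factors are 1 or -1, hence their own inverses, and \<open>sign\<close> can
    be solved for the crossings of the image.\<close>
  have "(- 1) ^ crossings \<pi> * (sign \<sigma> * ?P) =
      (- 1) ^ crossings (image \<sigma> ` \<pi>) * ((- 1) ^ crossings \<pi> * (- 1) ^ crossings \<pi>) * (?P * ?P)"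
    unfolding sign by (simp only: ac_simps)
  then show ?thesis by (simp only: cc PP mult_1_right)
qed

section \<open>The signed number of pair partitions\<close>

text \<open>The block \<open>{p, q}\<close> cannot be the first of a crossing, as nothing lies
  strictly between \<open>p\<close> and \<open>q\<close>, nor the second, as nothing lies below
  \<open>p\<close>.\<close>

lemma crossings_insert_two_smallest:
  assumes "p < q" "\<And>u. u \<in> \<Union>\<pi> \<Longrightarrow> q < u"
  shows "crossings (insert {p, q} \<pi>) = crossings \<pi>"
proof -
  have "{({i, j}, {i', j'}) | i j i' j'. {i, j} \<in> insert {p, q} \<pi> \<and> {i', j'} \<in> insert {p, q} \<pi> \<and>
          i < i' \<and> i' < j \<and> j < j'} =
        {({i, j}, {i', j'}) | i j i' j'. {i, j} \<in> \<pi> \<and> {i', j'} \<in> \<pi> \<and> i < i' \<and> i' < j \<and> j < j'}"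
    (is "{_ | i j i' j'. ?L i j i' j'} = {_ | i j i' j'. ?R i j i' j'}")
  proof -
    have "?L i j i' j' \<longleftrightarrow> ?R i j i' j'" for i j i' j'
    proof
      assume L: "?L i j i' j'"
      have *: "u = p \<or> u = q \<or> q < u" if "u \<in> \<Union>(insert {p, q} \<pi>)" for u
        using that assms(2) by auto
      have "{i, j} \<noteq> {p, q}"
        using L *[of i'] assms(1) by (fastforce simp: doubleton_eq_iff)
      moreover have "{i', j'} \<noteq> {p, q}"
        using L *[of i] *[of j] assms(1) by (fastforce simp: doubleton_eq_iff)
      ultimately show "?R i j i' j'" using L by auto
    qed auto
    then show ?thesis by simp
  qed
  then show ?thesis by (simp add: crossings_def)
qed

lemma pair_partitions_insert:
  assumes "p \<noteq> q" "p \<in> A" "q \<in> A"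
  shows "bij_betw (insert {p, q}) (pair_partitions (A - {p, q}))
           {\<pi> \<in> pair_partitions A. {p, q} \<in> \<pi>}"
proof (rule bij_betwI[where g = "\<lambda>\<pi>. \<pi> - {{p, q}}"])
  have notin: "{p, q} \<notin> \<pi>" if "\<pi> \<in> pair_partitions (A - {p, q})" for \<pi>
    using pair_partitionsD(5)[OF that] by blast
  show "insert {p, q} \<in> pair_partitions (A - {p, q}) \<rightarrow> {\<pi> \<in> pair_partitions A. {p, q} \<in> \<pi>}"
  proof
    fix \<pi> assume \<pi>: "\<pi> \<in> pair_partitions (A - {p, q})"
    note D = pair_partitionsD[OF \<pi>]
    have "partition_on A (insert {p, q} \<pi>)"
      using D assms by (auto simp: partition_on_def disjoint_def)
    then show "insert {p, q} \<pi> \<in> {\<pi> \<in> pair_partitions A. {p, q} \<in> \<pi>}"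
      using D(2) assms by (auto simp: pair_partitions_def)
  qed
  show "(\<lambda>\<pi>. \<pi> - {{p, q}}) \<in> {\<pi> \<in> pair_partitions A. {p, q} \<in> \<pi>} \<rightarrow> pair_partitions (A - {p, q})"
  proof
    fix \<pi> assume \<pi>: "\<pi> \<in> {\<pi> \<in> pair_partitions A. {p, q} \<in> \<pi>}"
    then have "\<pi> \<in> pair_partitions A" "{p, q} \<in> \<pi>" by auto
    note D = pair_partitionsD[OF this(1)]
    have "partition_on (A - {p, q}) (\<pi> - {{p, q}})"
      unfolding partition_on_def
    proof (intro conjI)
      show "\<Union> (\<pi> - {{p, q}}) = A - {p, q}"
        using D(6) D(7)[OF _ \<open>{p, q} \<in> \<pi>\<close>] by blast
    qed (use D(1) in \<open>auto simp: partition_on_def disjoint_def\<close>)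
    then show "\<pi> - {{p, q}} \<in> pair_partitions (A - {p, q})"
      using D(2) by (auto simp: pair_partitions_def)
  qed
  show "insert {p, q} \<pi> - {{p, q}} = \<pi>" if "\<pi> \<in> pair_partitions (A - {p, q})" for \<pi>
    using notin[OF that] by auto
qed auto

lemma pair_partitions_empty: "pair_partitions {} = {{}}"
  by (auto simp: pair_partitions_def partition_on_def)

text \<open>Swapping the two smallest elements flips the sign of every pair partition that does not pair
  them, so these cancel and induction applies to the rest.\<close>

lemma sum_crossings_sign:
  fixes A :: "'a::linorder set"
  assumes "finite A" "even (card A)"
  shows "(\<Sum>\<pi>\<in>pair_partitions A. (- 1) ^ crossings \<pi>) = (1 :: int)"
  using assms
proof (induction "card A" arbitrary: A rule: less_induct)
  case less
  show ?case
  proof (cases "A = {}")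
    case True
    then show ?thesis by (simp add: pair_partitions_empty crossings_def)
  next
    case False
    have "card A \<noteq> 1" using less.prems by auto
    then have A': "A - {Min A} \<noteq> {}"
      using False less.prems by (metis Min_in card_insert_disjoint card.empty empty_iff finite.emptyI insert_Diff One_nat_def)
    define p where "p = Min A"
    define q where "q = Min (A - {p})"
    have p: "p \<in> A" "\<And>u. u \<in> A \<Longrightarrow> p \<le> u"
      unfolding p_def using False less.prems by auto
    have q: "q \<in> A - {p}" "\<And>u. u \<in> A - {p} \<Longrightarrow> q \<le> u"
      unfolding q_def using Min_in[of "A - {p}"] A' less.prems p_def by auto
    have pq: "p < q" using p q by force
    have least: "q < u" if "u \<in> A - {p, q}" for u
      using that q(2)[of u] by auto
    let ?e = "\<lambda>\<pi>. (- 1 :: int) ^ crossings \<pi>"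
    let ?X = "{\<pi> \<in> pair_partitions A. {p, q} \<in> \<pi>}" and ?Y = "{\<pi> \<in> pair_partitions A. {p, q} \<notin> \<pi>}"
    let ?t = "Transposition.transpose p q"
    have t: "?t permutes A" using p q by (intro permutes_swap_id) auto
    have "sum ?e ?X = (\<Sum>\<pi>\<in>pair_partitions (A - {p, q}). ?e (insert {p, q} \<pi>))"
      using pair_partitions_insert[of p q A] pq p q by (intro sum.reindex_bij_betw[symmetric]) auto
    also have "\<dots> = (\<Sum>\<pi>\<in>pair_partitions (A - {p, q}). ?e \<pi>)"
      using pq least pair_partitionsD(6)[of _ "A - {p, q}"]
      by (intro sum.cong refl) (subst crossings_insert_two_smallest, auto)
    also have "\<dots> = 1"
    proof (rule less.hyps)
      have "card (A - {p, q}) = card A - 2"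
        using p q pq less.prems by (subst card_Diff_subset) auto
      moreover have "card A \<noteq> 0" using False less.prems(1) by (metis card_0_eq)
      ultimately show "card (A - {p, q}) < card A" "even (card (A - {p, q}))"
        using less.prems(2) by auto
    qed (use less.prems in auto)
    finally have X: "sum ?e ?X = 1" .
    \<comment> \<open>Exchanging the two smallest elements affects no comparison except the one
      between them. So no block of such a \<open>\<pi>\<close> is inverted, and
      \<open>crossings_image_sign\<close> leaves only the sign -1 of the transposition.\<close>
    have flip: "?e (image ?t ` \<pi>) = - ?e \<pi>" if \<pi>: "\<pi> \<in> ?Y" for \<pi>
    proof -
      have \<pi>': "\<pi> \<in> pair_partitions A" "{p, q} \<notin> \<pi>" using \<pi> by auto
      note D = pair_partitionsD[OF this(1)]
      have "order_sign (?t (Min B)) (?t (Max B)) = 1" if B: "B \<in> \<pi>" for B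
      proof -
        have B': "B = {Min B, Max B}" "Min B < Max B" using card_2_Min_Max[OF D(2)[OF B]] by auto
        then have "Min B \<in> A" "Max B \<in> A" using D(5)[OF B] by blast+
        moreover have "\<not> (Min B = p \<and> Max B = q)" using B' B \<pi>'(2) by metis
        ultimately show ?thesis
          using B'(2) pq least[of "Max B"] least[of "Min B"]
          by (auto simp: order_sign_def Transposition.transpose_def dest: leD p(2))
      qed
      then show ?thesis
        using crossings_image_sign[OF less.prems(1) t \<pi>'(1)] pq by (simp add: sign_swap_id)
    qed
    have "sum ?e ?Y = (\<Sum>\<pi>\<in>?Y. ?e (image ?t ` \<pi>))"
    proof (rule sum.reindex_bij_betw[symmetric])
      have "?t ` {p, q} = {p, q}" by (auto simp: Transposition.transpose_def)
      then have iff: "{p, q} \<in> image ?t ` \<pi> \<longleftrightarrow> {p, q} \<in> \<pi>" for \<pi>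
        using inj_image_mem_iff[OF inj_on_image[OF inj_on_subset[OF permutes_inj[OF t]]], of "{p, q}" \<pi>]
        by simp
      note bij = bij_betw_image_pair_partitions[OF t]
      have "image (image ?t) ` ?Y = ?Y"
      proof (intro equalityI subsetI)
        fix \<pi> assume "\<pi> \<in> ?Y"
        then have "\<pi> \<in> image (image ?t) ` pair_partitions A"
          using bij by (simp add: bij_betw_def)
        then obtain \<rho> where "\<rho> \<in> pair_partitions A" "\<pi> = image ?t ` \<rho>" by auto
        then show "\<pi> \<in> image (image ?t) ` ?Y" using \<open>\<pi> \<in> ?Y\<close> iff by auto
      qed (use bij iff in \<open>auto simp: bij_betw_def\<close>)
      then show "bij_betw (image (image ?t)) ?Y ?Y"
        using bij_betw_subset[OF bij, of ?Y] by auto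
    qed
    also have "\<dots> = - sum ?e ?Y"
      using flip by (simp add: sum_negf)
    finally have Y: "sum ?e ?Y = 0" by simp
    have "sum ?e (pair_partitions A) = sum ?e ?X + sum ?e ?Y"
      using finite_pair_partitions[OF less.prems(1)]
      by (subst sum.union_disjoint[symmetric]) (auto intro!: sum.cong)
    then show ?thesis using X Y by simp
  qed
qed

text \<open>By \<open>crossings_image_sign\<close> the term of \<open>\<pi>\<close> is
  \<open>sign \<sigma>\<close> times the crossing sign of the image of \<open>\<pi>\<close>; the
  images run through all pair partitions, whose signs add up to 1.\<close>

lemma pfaffian_order_sign_permutes:
  assumes "finite A" "even (card A)" "\<sigma> permutes A"
  shows "pfaffian A (\<lambda>i j. order_sign (\<sigma> i) (\<sigma> j)) = sign \<sigma>"
proof -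
  have *: "(- 1) ^ crossings \<pi> * (\<Prod>B\<in>\<pi>. order_sign (\<sigma> (Min B)) (\<sigma> (Max B))) =
      sign \<sigma> * (- 1) ^ crossings (image \<sigma> ` \<pi>)" if "\<pi> \<in> pair_partitions A" for \<pi>
    unfolding crossings_image_sign[OF assms(1,3) that] by (simp add: mult.left_commute)
  have "pfaffian A (\<lambda>i j. order_sign (\<sigma> i) (\<sigma> j)) =
      sign \<sigma> * (\<Sum>\<pi>\<in>pair_partitions A. (- 1) ^ crossings (image \<sigma> ` \<pi>))"
    by (simp add: pfaffian_def * sum_distrib_left)
  also have "(\<Sum>\<pi>\<in>pair_partitions A. (- 1) ^ crossings (image \<sigma> ` \<pi>)) =
      (\<Sum>\<pi>\<in>pair_partitions A. (- 1 :: int) ^ crossings \<pi>)"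
    by (rule sum.reindex_bij_betw[OF bij_betw_image_pair_partitions[OF assms(3)]])
  finally show ?thesis by (simp add: sum_crossings_sign assms)
qed

lemma pfaffian_of_int: "pfaffian A (\<lambda>i j. of_int (a i j)) = of_int (pfaffian A a)"
  by (simp add: pfaffian_def)

section \<open>The alcove as a fundamental domain\<close>

text \<open>\<open>\<tau>\<close> acts on indices: the linear part sends the \<open>i\<close>-th basis vector to the \<open>inv \<tau> i\<close>-th.\<close>

definition affine_perm :: "('n \<Rightarrow> 'n) \<Rightarrow> real^'n \<Rightarrow> real^'n \<Rightarrow> real^'n::finite" where
  "affine_perm \<tau> d y = (\<chi> j. y $ \<tau> j + d $ j)"

lemma affine_perm_nth [simp]: "affine_perm \<tau> d y $ j = y $ \<tau> j + d $ j"
  by (simp add: affine_perm_def)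

lemma permutes_basis_iff:
  "permutes_basis w \<longleftrightarrow> (\<exists>\<tau>. \<tau> permutes UNIV \<and> w = (\<lambda>y. \<chi> j. y $ \<tau> j))"
proof
  assume "permutes_basis w"
  then obtain \<sigma> where w: "linear w" "\<And>i. w (axis i 1) = axis (\<sigma> i) 1" and \<sigma>: "\<sigma> permutes UNIV"
    by (auto simp: permutes_basis_def)
  have "w y $ j = y $ inv \<sigma> j" for y j
  proof -
    have "w y = w (\<Sum>i\<in>UNIV. y $ i *\<^sub>R axis i 1)"
      using basis_expansion[of y] by (simp add: scalar_mult_eq_scaleR)
    also have "\<dots> = (\<Sum>i\<in>UNIV. y $ i *\<^sub>R axis (\<sigma> i) 1)"
      by (simp add: linear_sum[OF w(1)] linear_scale[OF w(1)] w(2))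
    also have "\<dots> $ j = (\<Sum>i\<in>UNIV. if i = inv \<sigma> j then y $ i else 0)"
      unfolding sum_component
      by (rule sum.cong) (use permutes_inverses[OF \<sigma>] in \<open>auto simp: axis_def\<close>)
    finally show ?thesis by simp
  qed
  then show "\<exists>\<tau>. \<tau> permutes UNIV \<and> w = (\<lambda>y. \<chi> j. y $ \<tau> j)"
    using permutes_inv[OF \<sigma>] by (intro exI[of _ "inv \<sigma>"]) (auto simp: vec_eq_iff)
next
  assume "\<exists>\<tau>. \<tau> permutes UNIV \<and> w = (\<lambda>y. \<chi> j. y $ \<tau> j)"
  then obtain \<tau> where \<tau>: "\<tau> permutes UNIV" "w = (\<lambda>y. \<chi> j. y $ \<tau> j)" by auto
  then have "linear w" by (auto intro!: linearI simp: vec_eq_iff)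
  moreover have "w (axis i 1) = axis (inv \<tau> i) 1" for i
  proof -
    have "\<tau> j = i \<longleftrightarrow> j = inv \<tau> i" for j
      using permutes_inverses[OF \<tau>(1)] by metis
    then show ?thesis by (auto simp: \<tau>(2) vec_eq_iff axis_def)
  qed
  ultimately show "permutes_basis w"
    using permutes_inv[OF \<tau>(1)] by (auto simp: permutes_basis_def)
qed

lemma affine_weyl_eq:
  "affine_weyl = {affine_perm \<tau> d | \<tau> d. \<tau> permutes UNIV \<and> d \<in> root_lattice}"
proof -
  have *: "affine_perm \<tau> d = (\<lambda>y. (\<chi> j. y $ \<tau> j) + d)" for \<tau> and d :: "real^'n"
    by (simp add: fun_eq_iff vec_eq_iff)
  show ?thesis
    unfolding affine_weyl_def permutes_basis_iff * by blast
qed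

text \<open>Subtracting the value at 0 removes \<open>d\<close>; what is left is the identity matrix
  with permuted rows. That \<open>\<tau>\<close> is inverse to the permutation of the basis does not
  change the sign.\<close>

lemma weyl_sign_affine_perm:
  assumes "\<tau> permutes UNIV"
  shows "weyl_sign (affine_perm \<tau> d) = sign \<tau>"
proof -
  have "matrix (\<lambda>y. affine_perm \<tau> d y - affine_perm \<tau> d 0) = (\<chi> i. mat 1 $ \<tau> i)"
    by (auto simp: matrix_def mat_def axis_def vec_eq_iff)
  then show ?thesis
    unfolding weyl_sign_def by (simp add: det_permute_rows[OF assms])
qed

lemma countable_root_lattice: "countable (root_lattice :: (real^'n) set)"
proof (rule countable_subset)
  show "root_lattice \<subseteq> range (\<lambda>f :: 'n \<Rightarrow> int. \<chi> i. of_int (f i))"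
  proof
    fix d :: "real^'n" assume "d \<in> root_lattice"
    then have "\<And>i. \<exists>n. d $ i = of_int n" by (auto simp: root_lattice_def Ints_def)
    then obtain f where "\<And>i. d $ i = of_int (f i)" by metis
    then show "d \<in> range (\<lambda>f :: 'n \<Rightarrow> int. \<chi> i. of_int (f i))"
      by (intro image_eqI[of _ _ f]) (auto simp: vec_eq_iff)
  qed
qed simp

lemma countable_affine_weyl: "countable (affine_weyl :: (real^'n \<Rightarrow> real^'n) set)"
proof (rule countable_subset)
  show "affine_weyl \<subseteq> case_prod affine_perm ` ({\<tau> :: 'n \<Rightarrow> 'n. \<tau> permutes UNIV} \<times> root_lattice)"
    by (auto simp: affine_weyl_eq)
  show "countable (case_prod affine_perm ` ({\<tau> :: 'n \<Rightarrow> 'n. \<tau> permutes UNIV} \<times> root_lattice))"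
    by (intro countable_image countable_SIGMA countable_root_lattice countable_finite) auto
qed

lemma affine_perm_inverse:
  assumes "\<tau> permutes UNIV"
  shows "affine_perm \<tau> d (affine_perm (inv \<tau>) (\<chi> i. - d $ inv \<tau> i) y) = y"
    and "affine_perm (inv \<tau>) (\<chi> i. - d $ inv \<tau> i) (affine_perm \<tau> d y) = y"
  by (simp_all add: vec_eq_iff permutes_inverses[OF assms])

section \<open>Ranks and sorting permutations\<close>

lemma card_less_strict_mono:
  fixes g :: "'a::finite \<Rightarrow> 'b::linorder"
  shows "g i < g j \<Longrightarrow> card {k. g k < g i} < card {k. g k < g j}"
  by (rule psubset_card_mono) auto

lemma card_less_iff:
  fixes g :: "'a::finite \<Rightarrow> 'b::linorder"
  shows "card {k. g k < g i} < card {k. g k < g j} \<longleftrightarrow> g i < g j"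
  using card_less_strict_mono[of g i j] card_less_strict_mono[of g j i]
  by (cases "g i" "g j" rule: linorder_cases) auto

text \<open>The number of smaller values is the rank of an index. Ranks serve both to construct a
  sorting permutation and to show that the order of its values determines a permutation.\<close>

lemma bij_betw_card_less:
  fixes g :: "'a::finite \<Rightarrow> 'b::linorder"
  assumes "inj g"
  shows "bij_betw (\<lambda>i. card {k. g k < g i}) UNIV {..<CARD('a)}"
proof -
  have inj: "inj (\<lambda>i. card {k. g k < g i})"
  proof (rule injI)
    fix i j assume "card {k. g k < g i} = card {k. g k < g j}"
    then have "g i = g j" using card_less_iff[of g i j] card_less_iff[of g j i] by auto
    then show "i = j" using assms by (auto dest: injD)
  qed
  moreover have "(\<lambda>i. card {k. g k < g i}) ` UNIV = {..<CARD('a)}"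
  proof (rule card_subset_eq)
    show "(\<lambda>i. card {k. g k < g i}) ` UNIV \<subseteq> {..<CARD('a)}"
      by (auto intro!: psubset_card_mono)
  qed (use inj in \<open>auto simp: card_image\<close>)
  ultimately show ?thesis by (simp add: bij_betw_def)
qed

lemma ex_sorting_permutation:
  fixes u :: "'n::{finite,linorder} \<Rightarrow> real"
  assumes "inj u"
  shows "\<exists>\<tau>. \<tau> permutes UNIV \<and> (\<forall>i j. i < j \<longrightarrow> u (\<tau> j) < u (\<tau> i))"
proof -
  let ?r = "\<lambda>i :: 'n. card {k. k < i}"
  let ?s = "\<lambda>i. card {k. - u k < - u i}"
  have r: "bij_betw ?r UNIV {..<CARD('n)}"
    using bij_betw_card_less[of "\<lambda>i :: 'n. i"] by simp
  have s: "bij_betw ?s UNIV {..<CARD('n)}"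
    using assms by (intro bij_betw_card_less) (auto simp: inj_def)
  \<comment> \<open>Position \<open>i\<close> receives the index whose value has, in decreasing
    order, the rank of \<open>i\<close>; hence \<open>u\<close> is negated in
    \<open>?s\<close>.\<close>
  define \<tau> where "\<tau> = inv_into UNIV ?s \<circ> ?r"
  have "bij_betw \<tau> UNIV UNIV"
    unfolding \<tau>_def by (rule bij_betw_trans[OF r bij_betw_inv_into[OF s]])
  moreover have "?s (\<tau> i) = ?r i" for i
    unfolding \<tau>_def o_def by (rule bij_betw_inv_into_right[OF s]) (use r in \<open>auto simp: bij_betw_def\<close>)
  then have "u (\<tau> j) < u (\<tau> i)" if "i < j" for i j
    using card_less_iff[of "\<lambda>k. - u k" "\<tau> i" "\<tau> j"] card_less_iff[of "\<lambda>k. k" i j] that by auto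
  ultimately show ?thesis by (auto intro: bij_imp_permutes)
qed

text \<open>As \<open>\<rho>\<close> is onto, the rank of \<open>\<rho> i\<close> in the index type
  is the number of \<open>k\<close> with \<open>\<rho> k < \<rho> i\<close>, which depends only on
  the order of the values.\<close>

lemma permutations_same_order_eq:
  fixes \<tau> \<tau>' :: "'n::{finite,linorder} \<Rightarrow> 'n"
  assumes "bij \<tau>" "bij \<tau>'" "\<And>i j. \<tau> i < \<tau> j \<longleftrightarrow> \<tau>' i < \<tau>' j"
  shows "\<tau> = \<tau>'"
proof
  fix i
  have *: "card {k. k < \<rho> i} = card {k. \<rho> k < \<rho> i}" if "bij \<rho>" for \<rho> :: "'n \<Rightarrow> 'n"
  proof -
    have "\<rho> ` {k. \<rho> k < \<rho> i} = {k. k < \<rho> i}" using bij_is_surj[OF that] by (auto simp: surj_def)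
    then show ?thesis using that by (metis bij_def card_image inj_on_subset subset_UNIV)
  qed
  have "card {k. k < \<tau> i} = card {k. k < \<tau>' i}"
    using *[OF assms(1)] *[OF assms(2)] assms(3) by simp
  then show "\<tau> i = \<tau>' i"
    using bij_betw_card_less[of "\<lambda>k :: 'n. k"] by (auto simp: bij_betw_def dest: injD)
qed

section \<open>Orbits of points of the alcove\<close>

lemma alcove_diff:
  fixes y :: "real^'n::{finite,linorder}"
  assumes "y \<in> alcove"
  shows "i < j \<Longrightarrow> y $ j < y $ i" "y $ i - y $ j < 1"
proof -
  show *: "i < j \<Longrightarrow> y $ j < y $ i" for i j using assms by (auto simp: alcove_def)
  have "y $ i \<le> y $ Min UNIV" using *[of "Min UNIV" i] Min_le[of UNIV i] by (auto simp: le_less)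
  moreover have "y $ Max UNIV \<le> y $ j" using *[of j "Max UNIV"] Max_ge[of UNIV j] by (auto simp: le_less)
  moreover have "y $ Min UNIV < 1 + y $ Max UNIV" using assms by (auto simp: alcove_def)
  ultimately show "y $ i - y $ j < 1" by linarith
qed

lemma alcove_less_iff:
  assumes "y \<in> alcove"
  shows "y $ j < y $ i \<longleftrightarrow> i < j"
  using alcove_diff(1)[OF assms, of i j] alcove_diff(1)[OF assms, of j i]
  by (cases i j rule: linorder_cases) auto

text \<open>The difference \<open>c\<close> of the translations is integral with sum 0. Were it
  nonzero, it would have an entry at least 1 and another at most -1; but two of its entries differ
  by less than 2, since coordinates in the alcove differ by less than 1. With equal translations,
  the order of the coordinates determines the permutation.\<close>

lemma alcove_images_disjoint:
  fixes y y' :: "real^'n::{finite,linorder}"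
  assumes "y \<in> alcove" "y' \<in> alcove" "\<omega> \<in> affine_weyl" "\<omega>' \<in> affine_weyl" "\<omega> y = \<omega>' y'"
  shows "\<omega> = \<omega>'"
proof -
  obtain \<tau> d \<tau>' d' where \<omega>: "\<omega> = affine_perm \<tau> d" "\<tau> permutes UNIV" "d \<in> root_lattice"
    and \<omega>': "\<omega>' = affine_perm \<tau>' d'" "\<tau>' permutes UNIV" "d' \<in> root_lattice"
    using assms(3,4) by (auto simp: affine_weyl_eq)
  have eq: "y $ \<tau> j + d $ j = y' $ \<tau>' j + d' $ j" for j
    using assms(5) \<omega> \<omega>' by (metis affine_perm_nth)
  define c where "c j = d' $ j - d $ j" for j
  have c_int: "c j \<in> \<int>" for j using \<omega>(3) \<omega>'(3) by (auto simp: c_def root_lattice_def)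
  have c_sum: "(\<Sum>j\<in>UNIV. c j) = 0"
    using \<omega>(3) \<omega>'(3) by (simp add: c_def root_lattice_def sum_subtractf)
  have c_diff: "c i - c j < 2" for i j
    using eq[of i] eq[of j] alcove_diff(2)[OF assms(1), of "\<tau> i" "\<tau> j"]
      alcove_diff(2)[OF assms(2), of "\<tau>' j" "\<tau>' i"] by (simp add: c_def)
  have c_abs: "\<bar>c j\<bar> \<ge> 1" if "c j \<noteq> 0" for j
    using c_int[of j] that by (rule Ints_nonzero_abs_ge1)
  have c0: "c j = 0" for j
  proof (rule ccontr)
    assume "c j \<noteq> 0"
    have "\<exists>i. c i > 0"
    proof (rule ccontr)
      assume "\<not> (\<exists>i. c i > 0)"
      then have "(\<Sum>j\<in>UNIV. - c j) = 0 \<longleftrightarrow> (\<forall>j\<in>UNIV. - c j = 0)"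
        by (intro sum_nonneg_eq_0_iff) (auto simp: not_less)
      then show False using c_sum \<open>c j \<noteq> 0\<close> by (simp add: sum_negf)
    qed
    moreover have "\<exists>i. c i < 0"
    proof (rule ccontr)
      assume "\<not> (\<exists>i. c i < 0)"
      then have "(\<Sum>j\<in>UNIV. c j) = 0 \<longleftrightarrow> (\<forall>j\<in>UNIV. c j = 0)"
        by (intro sum_nonneg_eq_0_iff) (auto simp: not_less)
      then show False using c_sum \<open>c j \<noteq> 0\<close> by simp
    qed
    ultimately obtain i k where "c i > 0" "c k < 0" by auto
    then show False using c_abs[of i] c_abs[of k] c_diff[of i k] by auto
  qed
  then have "d = d'" by (simp add: c_def vec_eq_iff)
  then have eq': "y $ \<tau> j = y' $ \<tau>' j" for j using eq[of j] by simp
  have "\<tau> = \<tau>'"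
  proof (rule permutations_same_order_eq)
    show "bij \<tau>" "bij \<tau>'" using \<omega>(2) \<omega>'(2) by (simp_all add: permutes_bij)
    show "\<tau> i < \<tau> j \<longleftrightarrow> \<tau>' i < \<tau>' j" for i j
      using alcove_less_iff[OF assms(1), of "\<tau> j" "\<tau> i"] alcove_less_iff[OF assms(2), of "\<tau>' j" "\<tau>' i"]
      by (simp add: eq')
  qed
  then show ?thesis using \<omega>(1) \<omega>'(1) \<open>d = d'\<close> by simp
qed

text \<open>A lattice point nearest to \<open>x\<close> works: replacing \<open>d\<close> by \<open>d - e\<^sub>i + e\<^sub>j\<close> must not decrease the
  distance.\<close>

lemma ex_lattice_translate_spread_less_1:
  fixes x :: "real^'n::finite"
  assumes "\<And>i j. i \<noteq> j \<Longrightarrow> x $ i - x $ j \<notin> \<int>"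
  shows "\<exists>d\<in>root_lattice. \<forall>i j. (x - d) $ i - (x - d) $ j < 1"
proof -
  define Q where "Q d = (\<Sum>i\<in>UNIV. (x $ i - of_int (d i))\<^sup>2)" for d :: "'n \<Rightarrow> int"
  \<comment> \<open>Lattice points no farther from \<open>x\<close> than 0: a finite nonempty set,
    so a nearest one exists, and it is nearest in the whole lattice.\<close>
  define K where "K = {d. (\<Sum>i\<in>UNIV. d i) = 0 \<and> Q d \<le> Q (\<lambda>_. 0)}"
  \<comment> \<open>The size of \<open>d i\<close> is at most that of \<open>x $ i\<close>, bounded
    by the norm, plus that of \<open>x $ i - d i\<close>, bounded by the root of
    \<open>Q\<close>.\<close>
  define r where "r = \<lceil>norm x + sqrt (Q (\<lambda>_. 0))\<rceil>"
  have "finite K"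
  proof (rule finite_subset)
    show "K \<subseteq> UNIV \<rightarrow>\<^sub>E {- r..r}"
    proof
      fix d assume d: "d \<in> K"
      have "d i \<in> {- r..r}" for i
      proof -
        have "(x $ i - of_int (d i))\<^sup>2 \<le> Q d"
          unfolding Q_def by (rule member_le_sum) auto
        also have "Q d \<le> Q (\<lambda>_. 0)" using d by (simp add: K_def)
        finally have "\<bar>x $ i - of_int (d i)\<bar> \<le> sqrt (Q (\<lambda>_. 0))"
          by (metis real_sqrt_abs real_sqrt_le_iff)
        then have "\<bar>of_int (d i)\<bar> \<le> norm x + sqrt (Q (\<lambda>_. 0))"
          using component_le_norm_cart[of x i] by linarith
        then have "\<bar>of_int (d i) :: real\<bar> \<le> of_int r"
          unfolding r_def by linarith
        then show ?thesis by (simp add: abs_le_iff)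
      qed
      then show "d \<in> UNIV \<rightarrow>\<^sub>E {- r..r}" by auto
    qed
    show "finite ((UNIV :: 'n set) \<rightarrow>\<^sub>E {- r..r})" by (rule finite_PiE) auto
  qed
  moreover have "(\<lambda>_. 0) \<in> K" by (simp add: K_def)
  ultimately obtain d where d: "d \<in> K" "\<And>d'. d' \<in> K \<Longrightarrow> Q d \<le> Q d'"
    by (metis arg_min_if_finite(1) arg_min_least empty_iff)
  have d_sum: "(\<Sum>i\<in>UNIV. d i) = 0" using d by (simp add: K_def)
  have d_min: "Q d \<le> Q d'" if "(\<Sum>i\<in>UNIV. d' i) = 0" for d'
  proof (cases "d' \<in> K")
    case False
    then have "Q (\<lambda>_. 0) < Q d'" using that by (simp add: K_def)
    moreover have "Q d \<le> Q (\<lambda>_. 0)" using d(1) by (simp add: K_def)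
    ultimately show ?thesis by simp
  qed (rule d(2))
  define u where "u i = x $ i - of_int (d i)" for i
  have "u j - u i < 1" for i j
  proof (cases "i = j")
    case False
    define d' where "d' k = d k - (if k = i then 1 else 0) + (if k = j then 1 else 0)" for k
    have "(\<Sum>i\<in>UNIV. d' i) = 0"
      by (simp add: d'_def sum.distrib sum_subtractf d_sum)
    then have "Q d \<le> Q d'" by (rule d_min)
    \<comment> \<open>Only two coordinates change: \<open>u i\<close> grows by 1 and
      \<open>u j\<close> drops by 1. The sum is \<open>2 * (1 + u i - u j)\<close>, and minimality
      makes it nonnegative.\<close>
    moreover have "Q d' - Q d = (\<Sum>k\<in>UNIV. (if k = i then 2 * u i + 1 else 0) + (if k = j then 1 - 2 * u j else 0))"
      unfolding Q_def sum_subtractf[symmetric]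
      by (rule sum.cong) (use False in \<open>auto simp: d'_def u_def power2_eq_square algebra_simps\<close>)
    ultimately have "u j - u i \<le> 1"
      by (simp add: sum.distrib)
    \<comment> \<open>Minimality leaves the case of equality open; it is excluded because
      \<open>x\<close> lies on no wall.\<close>
    moreover have "u j - u i \<noteq> 1"
    proof
      assume "u j - u i = 1"
      then have "x $ j - x $ i = of_int (1 + d j - d i)" by (simp add: u_def)
      then show False using assms[of j i] False by (metis Ints_of_int)
    qed
    ultimately show ?thesis by simp
  qed simp
  moreover have "(\<chi> i. of_int (d i)) \<in> root_lattice"
    using d_sum by (auto simp: root_lattice_def of_int_sum[symmetric] simp del: of_int_sum)
  ultimately show ?thesis
    by (intro bexI[of _ "\<chi> i. of_int (d i)"]) (auto simp: u_def)
qed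

text \<open>Once a translation has made the spread of the coordinates less than 1, sorting them in
  decreasing order gives a point of the alcove. There are no ties because \<open>x\<close> lies on
  no wall.\<close>

lemma alcove_images_cover:
  fixes x :: "real^'n::{finite,linorder}"
  assumes "\<And>i j. i \<noteq> j \<Longrightarrow> x $ i - x $ j \<notin> \<int>"
  shows "\<exists>y\<in>alcove. \<exists>\<omega>\<in>affine_weyl. \<omega> y = x"
proof -
  obtain d where d: "d \<in> root_lattice" "\<And>i j. (x - d) $ i - (x - d) $ j < 1"
    using ex_lattice_translate_spread_less_1[of x] assms by auto
  have "inj (\<lambda>i. (x - d) $ i)"
  proof (rule injI, rule ccontr)
    fix i j assume "(x - d) $ i = (x - d) $ j" "i \<noteq> j"
    then have "x $ i - x $ j = d $ i - d $ j" by simp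
    then show False using assms[OF \<open>i \<noteq> j\<close>] d(1) by (auto simp: root_lattice_def)
  qed
  then obtain \<tau> where \<tau>: "\<tau> permutes UNIV" "\<And>i j. i < j \<Longrightarrow> (x - d) $ \<tau> j < (x - d) $ \<tau> i"
    using ex_sorting_permutation by blast
  define y where "y = (\<chi> i. (x - d) $ \<tau> i)"
  have "y \<in> alcove"
    using \<tau>(2) d(2)[of "\<tau> (Min UNIV)" "\<tau> (Max UNIV)"] by (simp add: alcove_def y_def)
  moreover have "affine_perm (inv \<tau>) d y = x"
    by (simp add: vec_eq_iff y_def permutes_inverses[OF \<tau>(1)])
  ultimately show ?thesis
    using d(1) permutes_inv[OF \<tau>(1)] by (auto simp: affine_weyl_eq)
qed

section \<open>Coordinatewise integration\<close>

lemma prod_Basis_vec: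
  "(\<Prod>b\<in>(Basis :: (real^'n) set). g b) = (\<Prod>i\<in>UNIV. g (axis i (1::real)))"
proof -
  have Basis: "(Basis :: (real^'n) set) = range (\<lambda>i. axis i 1)"
    by (auto simp: Basis_vec_def)
  have "inj (\<lambda>i :: 'n. axis i (1::real))" by (auto simp: inj_def axis_eq_axis)
  then show ?thesis unfolding Basis by (subst prod.reindex) (auto simp: o_def)
qed

lemma emeasure_lborel_box_vec:
  fixes l u :: "real^'n"
  assumes "\<And>i. l $ i \<le> u $ i"
  shows "emeasure lborel (box l u) = ennreal (\<Prod>i\<in>UNIV. u $ i - l $ i)"
proof -
  have "emeasure lborel (box l u) = ennreal (\<Prod>b\<in>Basis. (u - l) \<bullet> b)"
    using assms by (intro emeasure_lborel_box) (auto simp: Basis_vec_def inner_axis)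
  then show ?thesis by (simp add: prod_Basis_vec inner_axis)
qed

lemma lborel_vec_eqI:
  fixes M :: "(real^'n) measure"
  assumes "\<And>l u. (\<And>i. l $ i \<le> u $ i) \<Longrightarrow> emeasure M (box l u) = ennreal (\<Prod>i\<in>UNIV. u $ i - l $ i)"
    and "sets M = sets borel"
  shows "M = lborel"
proof (rule lborel_eqI[symmetric])
  fix l u :: "real^'n" assume "\<And>b. b \<in> Basis \<Longrightarrow> l \<bullet> b \<le> u \<bullet> b"
  then have "l $ i \<le> u $ i" for i
    by (metis Basis_real_def axis_in_Basis_iff inner_axis inner_real_def mult.right_neutral singletonI)
  then show "emeasure M (box l u) = (\<Prod>b\<in>Basis. (u - l) \<bullet> b)"
    by (simp add: assms(1) prod_Basis_vec inner_axis)
qed fact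

lemma borel_measurable_vec_lambda:
  fixes f :: "'n::finite \<Rightarrow> 'a \<Rightarrow> real"
  assumes "\<And>i. f i \<in> borel_measurable M"
  shows "(\<lambda>x. \<chi> i. f i x) \<in> borel_measurable M"
  unfolding borel_measurable_euclidean_space[where f = "\<lambda>x. \<chi> i. f i x"]
  using assms by (auto simp: Basis_vec_def inner_axis)

lemma borel_measurable_vec_nth [measurable]: "(\<lambda>x :: real^'n. x $ i) \<in> borel_measurable borel"
  by (intro borel_measurable_continuous_onI continuous_intros)

interpretation lborel_product: product_sigma_finite "\<lambda>_. lborel :: real measure" ..

text \<open>Carries integrals over \<open>real^'n\<close> to a product measure, where the
  coordinates of each block can be integrated separately.\<close>

lemma distr_vec_lambda_lborel:
  "distr (Pi\<^sub>M UNIV (\<lambda>_ :: 'n. lborel :: real measure)) borel vec_lambda = (lborel :: (real^'n) measure)"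
proof (rule lborel_vec_eqI)
  fix l u :: "real^'n" assume le: "\<And>i. l $ i \<le> u $ i"
  have meas: "vec_lambda \<in> Pi\<^sub>M UNIV (\<lambda>_ :: 'n. lborel :: real measure) \<rightarrow>\<^sub>M borel"
    using borel_measurable_vec_lambda[of "\<lambda>i x. x i" "Pi\<^sub>M UNIV (\<lambda>_ :: 'n. lborel :: real measure)"]
    by simp
  have "emeasure (distr (Pi\<^sub>M UNIV (\<lambda>_ :: 'n. lborel :: real measure)) borel vec_lambda) (box l u) =
      emeasure (Pi\<^sub>M UNIV (\<lambda>_ :: 'n. lborel :: real measure)) (Pi\<^sub>E UNIV (\<lambda>i. {l $ i<..<u $ i}))"
    by (subst emeasure_distr[OF meas]) (auto simp: mem_box_cart space_PiM PiE_def Pi_def intro!: arg_cong2[where f = emeasure])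
  also have "\<dots> = ennreal (\<Prod>i\<in>UNIV. u $ i - l $ i)"
    by (subst lborel_product.emeasure_PiM) (auto simp: le prod_ennreal)
  finally show "emeasure (distr (Pi\<^sub>M UNIV (\<lambda>_ :: 'n. lborel :: real measure)) borel vec_lambda) (box l u) =
      ennreal (\<Prod>i\<in>UNIV. u $ i - l $ i)" .
qed simp

lemma measurable_vec_lambda [measurable]:
  "vec_lambda \<in> Pi\<^sub>M UNIV (\<lambda>_ :: 'n::finite. lborel :: real measure) \<rightarrow>\<^sub>M borel"
  using borel_measurable_vec_lambda[of "\<lambda>i x. x i" "Pi\<^sub>M UNIV (\<lambda>_ :: 'n. lborel :: real measure)"]
  by simp

lemma integrable_lborel_vec:
  fixes F :: "real^'n \<Rightarrow> real"
  assumes "F \<in> borel_measurable borel"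
  shows "integrable lborel F \<longleftrightarrow>
    integrable (Pi\<^sub>M UNIV (\<lambda>_ :: 'n. lborel :: real measure)) (\<lambda>x. F (vec_lambda x))"
  using integrable_distr_eq[OF measurable_vec_lambda assms] by (simp add: distr_vec_lambda_lborel)

lemma integral_lborel_vec:
  fixes F :: "real^'n \<Rightarrow> real"
  assumes "F \<in> borel_measurable borel"
  shows "(LINT x|lborel. F x) = (LINT x|Pi\<^sub>M UNIV (\<lambda>_ :: 'n. lborel). F (vec_lambda x))"
  using integral_distr[OF measurable_vec_lambda assms] by (simp add: distr_vec_lambda_lborel)

section \<open>Integrals of products over blocks\<close>

lemma measurable_floor_sign [measurable]:
  "(\<lambda>t :: real. (- 1) powi \<lfloor>t\<rfloor> :: real) \<in> borel_measurable borel"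
  by (rule measurable_compose[OF measurable_real_floor]) simp

lemma abs_floor_sign [simp]: "\<bar>(- 1) powi n :: real\<bar> = 1"
  by (simp add: power_int_abs)

lemma J_integrand_measurable:
  assumes [measurable]: "\<And>i. f i \<in> borel_measurable borel"
  shows "J_integrand f i j \<in> borel_measurable borel"
  unfolding J_integrand_def borel_prod[symmetric] by measurable

lemma abs_J_integrand: "\<bar>J_integrand f i j (y, z)\<bar> = \<bar>f i y\<bar> * \<bar>f j z\<bar>"
  by (simp add: J_integrand_def abs_mult)

lemma integrable_J_integrand:
  assumes "\<And>i. integrable lborel (f i)"
  shows "integrable lborel (J_integrand f i j)"
proof -
  have [measurable]: "f i \<in> borel_measurable borel" for i
    using borel_measurable_integrable[OF assms] by simp
  have "integrable (lborel \<Otimes>\<^sub>M lborel) (J_integrand f i j)"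
  proof (rule lborel_pair.Fubini_integrable)
    have J [measurable]: "J_integrand f i j \<in> borel_measurable borel"
      by (rule J_integrand_measurable) simp
    then show "J_integrand f i j \<in> borel_measurable (lborel \<Otimes>\<^sub>M lborel)"
      by (simp add: lborel_prod)
    show "integrable lborel (\<lambda>y. LINT z|lborel. norm (J_integrand f i j (y, z)))"
      using assms by (simp add: abs_J_integrand)
    show "AE y in lborel. integrable lborel (\<lambda>z. J_integrand f i j (y, z))"
    proof (rule AE_I2)
      fix y
      show "integrable lborel (\<lambda>z. J_integrand f i j (y, z))"
        by (rule Bochner_Integration.integrable_bound[OF integrable_mult_right[OF assms[of j], of "f i y"]])
          (auto simp: abs_J_integrand abs_mult J_integrand_def)
    qed
  qed
  then show ?thesis by (simp add: lborel_prod)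
qed

lemma integral_PiM_doubleton:
  fixes h :: "real \<times> real \<Rightarrow> real"
  assumes "i \<noteq> j" "integrable lborel h"
    and "integrable (Pi\<^sub>M {i, j} (\<lambda>_. lborel)) (\<lambda>x. h (x i, x j))"
  shows "(LINT x|Pi\<^sub>M {i, j} (\<lambda>_. lborel). h (x i, x j)) = (LINT p|lborel. h p)"
proof -
  have int: "integrable (lborel \<Otimes>\<^sub>M lborel) h"
    using assms(2) by (simp add: lborel_prod)
  have int': "integrable (lborel \<Otimes>\<^sub>M lborel) (case_prod (\<lambda>y z. h (y, z)))"
    using int by (simp add: case_prod_unfold)
  have "(LINT x|Pi\<^sub>M {i, j} (\<lambda>_. lborel). h (x i, x j)) =
      (LINT x|Pi\<^sub>M {j} (\<lambda>_. lborel). LINT y|lborel. h ((x(i := y)) i, (x(i := y)) j))"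
    using assms(1,3) by (intro lborel_product.product_integral_insert) auto
  also have "\<dots> = (LINT x|Pi\<^sub>M {j} (\<lambda>_. lborel). (\<lambda>z. LINT y|lborel. h (y, z)) (x j))"
    using assms(1) by simp
  also have "\<dots> = (LINT z|lborel. LINT y|lborel. h (y, z))"
    by (rule lborel_product.product_integral_singleton)
      (use lborel_pair.integrable_snd[OF int'] in auto)
  also have "\<dots> = (LINT p|(lborel \<Otimes>\<^sub>M lborel). h p)"
    using lborel_pair.integral_snd[OF int'] by (simp add: case_prod_unfold)
  finally show ?thesis by (simp add: lborel_prod)
qed

text \<open>Floor signs have modulus 1, so the product has the modulus of the product of the
  \<open>f i (x i)\<close>. The family of blocks is arbitrary, not a partition of all indices,
  because the next induction removes blocks one by one.\<close>

lemma integrable_prod_J_integrand: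
  fixes f :: "'n::linorder \<Rightarrow> real \<Rightarrow> real"
  assumes f: "\<And>i. integrable lborel (f i)"
    and \<pi>: "finite \<pi>" "disjoint \<pi>" "\<And>B. B \<in> \<pi> \<Longrightarrow> B = {Min B, Max B} \<and> Min B \<noteq> Max B"
  shows "integrable (Pi\<^sub>M (\<Union>\<pi>) (\<lambda>_. lborel))
           (\<lambda>x. \<Prod>B\<in>\<pi>. J_integrand f (Min B) (Max B) (x (Min B), x (Max B)))"
proof -
  have fin: "finite B" if "B \<in> \<pi>" for B using \<pi>(3)[OF that] by (metis finite.emptyI finite.insertI)
  have MM: "Min B \<in> \<Union>\<pi>" "Max B \<in> \<Union>\<pi>" if "B \<in> \<pi>" for B using \<pi>(3)[OF that] that by blast+
  have [measurable]: "f i \<in> borel_measurable borel" for i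
    using borel_measurable_integrable[OF f] by simp
  have "integrable (Pi\<^sub>M (\<Union>\<pi>) (\<lambda>_. lborel)) (\<lambda>x. \<Prod>i\<in>\<Union>\<pi>. f i (x i))"
    using \<pi>(1) fin f by (intro lborel_product.product_integrable_prod) auto
  then show ?thesis
  proof (rule Bochner_Integration.integrable_bound)
    show "(\<lambda>x. \<Prod>B\<in>\<pi>. J_integrand f (Min B) (Max B) (x (Min B), x (Max B)))
        \<in> borel_measurable (Pi\<^sub>M (\<Union>\<pi>) (\<lambda>_. lborel))"
    proof (rule borel_measurable_prod)
      fix B assume "B \<in> \<pi>"
      note [measurable] = MM[OF this] 
      show "(\<lambda>x. J_integrand f (Min B) (Max B) (x (Min B), x (Max B)))
        \<in> borel_measurable (Pi\<^sub>M (\<Union>\<pi>) (\<lambda>_. lborel))"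
        unfolding J_integrand_def by measurable
    qed
    have "\<bar>\<Prod>B\<in>\<pi>. J_integrand f (Min B) (Max B) (x (Min B), x (Max B))\<bar> = \<bar>\<Prod>i\<in>\<Union>\<pi>. f i (x i)\<bar>" for x
    proof -
      have "(\<Prod>i\<in>\<Union>\<pi>. \<bar>f i (x i)\<bar>) = (\<Prod>B\<in>\<pi>. \<Prod>i\<in>B. \<bar>f i (x i)\<bar>)"
        using \<pi>(2) fin by (subst prod.Union_disjoint) (auto simp: disjoint_def)
      also have "\<dots> = (\<Prod>B\<in>\<pi>. \<bar>J_integrand f (Min B) (Max B) (x (Min B), x (Max B))\<bar>)"
      proof (rule prod.cong[OF refl])
        fix B assume "B \<in> \<pi>"
        then have B: "B = {Min B, Max B}" "Min B \<noteq> Max B" using \<pi>(3) by auto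
        have "(\<Prod>i\<in>B. \<bar>f i (x i)\<bar>) = (\<Prod>i\<in>{Min B, Max B}. \<bar>f i (x i)\<bar>)"
          by (rule prod.cong[OF B(1) refl])
        also have "\<dots> = \<bar>J_integrand f (Min B) (Max B) (x (Min B), x (Max B))\<bar>"
          using B(2) by (simp add: abs_J_integrand)
        finally show "(\<Prod>i\<in>B. \<bar>f i (x i)\<bar>) = \<bar>J_integrand f (Min B) (Max B) (x (Min B), x (Max B))\<bar>" .
      qed
      finally show ?thesis by (simp add: abs_prod)
    qed
    then show "AE x in Pi\<^sub>M (\<Union>\<pi>) (\<lambda>_. lborel).
        norm (\<Prod>B\<in>\<pi>. J_integrand f (Min B) (Max B) (x (Min B), x (Max B))) \<le> norm (\<Prod>i\<in>\<Union>\<pi>. f i (x i))"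
      by simp
  qed
qed

lemma integral_prod_J_integrand:
  fixes f :: "'n::linorder \<Rightarrow> real \<Rightarrow> real"
  assumes f: "\<And>i. integrable lborel (f i)"
    and \<pi>: "finite \<pi>" "disjoint \<pi>" "\<And>B. B \<in> \<pi> \<Longrightarrow> B = {Min B, Max B} \<and> Min B \<noteq> Max B"
  shows "(LINT x|Pi\<^sub>M (\<Union>\<pi>) (\<lambda>_. lborel).
           (\<Prod>B\<in>\<pi>. J_integrand f (Min B) (Max B) (x (Min B), x (Max B)))) =
         (\<Prod>B\<in>\<pi>. LINT p|lborel. J_integrand f (Min B) (Max B) p)"
  using \<pi>
proof (induction \<pi>)
  case empty
  then show ?case by (simp add: PiM_empty lebesgue_integral_count_space_finite)
next
  case (insert B \<pi>)
  let ?J = "\<lambda>B x. J_integrand f (Min B) (Max B) (x (Min B), x (Max B))"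
  have fin: "finite C" if "C \<in> insert B \<pi>" for C
    using insert.prems(2)[OF that] by (metis finite.emptyI finite.insertI)
  have MM: "Min C \<in> C" "Max C \<in> C" if "C \<in> insert B \<pi>" for C using insert.prems(2)[OF that] by blast+
  have disj: "\<Union>\<pi> \<inter> B = {}" using insert.prems(1) insert.hyps(2) by (auto simp: disjoint_def)
  have B: "B = {Min B, Max B}" "Min B \<noteq> Max B" using insert.prems(2)[of B] by auto
  have "(LINT x|Pi\<^sub>M (\<Union>(insert B \<pi>)) (\<lambda>_. lborel). (\<Prod>C\<in>insert B \<pi>. ?J C x)) =
      (LINT x|Pi\<^sub>M (\<Union>\<pi> \<union> B) (\<lambda>_. lborel). (\<Prod>C\<in>insert B \<pi>. ?J C x))"
    by (simp add: Un_commute)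
  also have "\<dots> = (LINT x|Pi\<^sub>M (\<Union>\<pi>) (\<lambda>_. lborel). LINT y|Pi\<^sub>M B (\<lambda>_. lborel).
      (\<Prod>C\<in>insert B \<pi>. ?J C (merge (\<Union>\<pi>) B (x, y))))"
    using disj insert.hyps(1) fin integrable_prod_J_integrand[OF f _ insert.prems, of "\<lambda>i. i"]
    by (intro lborel_product.product_integral_fold) (auto simp: Un_commute)
  \<comment> \<open>Each factor reads only the two coordinates of its own block, so \<open>x\<close>
    and \<open>y\<close> separate.\<close>
  also have "(\<lambda>x y. \<Prod>C\<in>insert B \<pi>. ?J C (merge (\<Union>\<pi>) B (x, y))) = (\<lambda>x y. (\<Prod>C\<in>\<pi>. ?J C x) * ?J B y)"
  proof (intro ext)
    fix x y :: "'n \<Rightarrow> real"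
    have "?J C (merge (\<Union>\<pi>) B (x, y)) = ?J C x" if "C \<in> \<pi>" for C
      using MM[of C] that disj by (simp add: merge_def) blast
    moreover have "?J B (merge (\<Union>\<pi>) B (x, y)) = ?J B y"
      using MM[of B] disj by (simp add: merge_def) blast
    ultimately show "(\<Prod>C\<in>insert B \<pi>. ?J C (merge (\<Union>\<pi>) B (x, y))) = (\<Prod>C\<in>\<pi>. ?J C x) * ?J B y"
      using insert.hyps by (simp add: mult.commute)
  qed
  also have "(LINT x|Pi\<^sub>M (\<Union>\<pi>) (\<lambda>_. lborel). LINT y|Pi\<^sub>M B (\<lambda>_. lborel). (\<Prod>C\<in>\<pi>. ?J C x) * ?J B y) =
      (LINT x|Pi\<^sub>M (\<Union>\<pi>) (\<lambda>_. lborel). (\<Prod>C\<in>\<pi>. ?J C x)) * (LINT y|Pi\<^sub>M B (\<lambda>_. lborel). ?J B y)"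
    by simp
  also have "(LINT x|Pi\<^sub>M (\<Union>\<pi>) (\<lambda>_. lborel). (\<Prod>C\<in>\<pi>. ?J C x)) =
      (\<Prod>C\<in>\<pi>. LINT p|lborel. J_integrand f (Min C) (Max C) p)"
    using insert.prems by (intro insert.IH) (auto simp: disjoint_def)
  also have "(LINT y|Pi\<^sub>M B (\<lambda>_. lborel). ?J B y) = (LINT p|lborel. J_integrand f (Min B) (Max B) p)"
  proof -
    have "integrable (Pi\<^sub>M B (\<lambda>_. lborel)) (?J B)"
      using integrable_prod_J_integrand[OF f, of "{B}"] B by (simp add: disjoint_def)
    then show ?thesis
      using integral_PiM_doubleton[OF B(2) integrable_J_integrand[OF f]] B(1) by simp
  qed
  finally show ?case using insert.hyps by (simp add: mult.commute)
qed

section \<open>Unfolding the alcove integral\<close>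

lemma affine_perm_measurable: "affine_perm \<tau> d \<in> borel \<rightarrow>\<^sub>M borel"
  unfolding affine_perm_def by (intro borel_measurable_vec_lambda) measurable

text \<open>The preimage of a box is a box with the same side lengths in another order.\<close>

lemma distr_affine_perm:
  fixes d :: "real^'n"
  assumes "\<tau> permutes UNIV"
  shows "distr lborel borel (affine_perm \<tau> d) = lborel"
proof (rule lborel_vec_eqI)
  fix l u :: "real^'n" assume le: "\<And>i. l $ i \<le> u $ i"
  let ?shift = "\<lambda>a :: real^'n. \<chi> i. a $ inv \<tau> i - d $ inv \<tau> i"
  have "affine_perm \<tau> d y \<in> box l u \<longleftrightarrow> y \<in> box (?shift l) (?shift u)" for y
  proof -
    have "affine_perm \<tau> d y \<in> box l u \<longleftrightarrow> (\<forall>j. l $ j - d $ j < y $ \<tau> j \<and> y $ \<tau> j < u $ j - d $ j)"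
      by (auto simp: mem_box_cart algebra_simps)
    also have "\<dots> \<longleftrightarrow> (\<forall>i. l $ inv \<tau> i - d $ inv \<tau> i < y $ i \<and> y $ i < u $ inv \<tau> i - d $ inv \<tau> i)"
      using permutes_inverses[OF assms] by metis
    finally show ?thesis by (simp add: mem_box_cart)
  qed
  then have "affine_perm \<tau> d -` box l u = box (?shift l) (?shift u)" by auto
  then have "emeasure (distr lborel borel (affine_perm \<tau> d)) (box l u) =
      emeasure lborel (box (?shift l) (?shift u))"
    by (subst emeasure_distr) (auto simp: affine_perm_measurable)
  also have "\<dots> = ennreal (\<Prod>i\<in>UNIV. u $ inv \<tau> i - l $ inv \<tau> i)"
    by (subst emeasure_lborel_box_vec) (auto simp: le)
  also have "(\<Prod>i\<in>UNIV. u $ inv \<tau> i - l $ inv \<tau> i) = (\<Prod>i\<in>UNIV. u $ i - l $ i)"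
    by (rule prod.reindex_bij_betw[OF permutes_imp_bij[OF permutes_inv[OF assms]]])
  finally show "emeasure (distr lborel borel (affine_perm \<tau> d)) (box l u) =
      ennreal (\<Prod>i\<in>UNIV. u $ i - l $ i)" .
qed simp

lemma affine_weyl_measurable: "\<omega> \<in> affine_weyl \<Longrightarrow> \<omega> \<in> borel \<rightarrow>\<^sub>M borel"
  by (auto simp: affine_weyl_eq affine_perm_measurable)

lemma distr_affine_weyl: "\<omega> \<in> affine_weyl \<Longrightarrow> distr lborel borel \<omega> = lborel"
  by (auto simp: affine_weyl_eq distr_affine_perm)

text \<open>The image is the preimage under the inverse, which is again a measure-preserving affine
  permutation.\<close>

lemma affine_weyl_image:
  assumes "\<omega> \<in> affine_weyl" "S \<in> sets borel"
  shows "\<omega> ` S \<in> sets borel" "emeasure lborel (\<omega> ` S) = emeasure lborel S"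
proof -
  obtain \<tau> d where \<omega>: "\<omega> = affine_perm \<tau> d" "\<tau> permutes UNIV"
    using assms(1) by (auto simp: affine_weyl_eq)
  define \<omega>' where "\<omega>' = affine_perm (inv \<tau>) (\<chi> i. - d $ inv \<tau> i)"
  have \<omega>': "\<omega>' \<in> borel \<rightarrow>\<^sub>M borel" "distr lborel borel \<omega>' = lborel"
    unfolding \<omega>'_def using affine_perm_measurable distr_affine_perm permutes_inv[OF \<omega>(2)] by blast+
  have eq: "\<omega> ` S = \<omega>' -` S"
    using affine_perm_inverse[OF \<omega>(2), of d] unfolding \<omega>(1) \<omega>'_def by (auto intro: rev_image_eqI)
  then show "\<omega> ` S \<in> sets borel"
    using measurable_sets[OF \<omega>'(1) assms(2)] by simp
  show "emeasure lborel (\<omega> ` S) = emeasure lborel S"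
    using emeasure_distr[of \<omega>' lborel borel S] \<omega>' assms(2) by (simp add: eq)
qed

text \<open>The walls are countably many hyperplanes, hence negligible together.\<close>

lemma AE_coordinate_diff_notin_Ints:
  "AE x in lborel. \<forall>i j. i \<noteq> j \<longrightarrow> (x :: real^'n::finite) $ i - x $ j \<notin> \<int>"
proof -
  have "AE x in lborel. \<forall>n :: int. i \<noteq> j \<longrightarrow> (x :: real^'n) $ i - x $ j \<noteq> of_int n" for i j
  proof (cases "i = j")
    case False
    have "AE x in lborel. (x :: real^'n) $ i - x $ j \<noteq> of_int n" for n
    proof -
      let ?a = "axis i 1 - axis j 1 :: real^'n"
      have "?a \<noteq> 0" using False by (auto simp: vec_eq_iff axis_def)
      then have "negligible {x. ?a \<bullet> x = of_int n}" by (simp add: negligible_hyperplane)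
      then have "{x. ?a \<bullet> x = of_int n} \<in> null_sets lebesgue" by (simp add: negligible_iff_null_sets)
      moreover have "{x. ?a \<bullet> x = of_int n} \<in> sets lborel" using closed_hyperplane by auto
      ultimately have "{x. ?a \<bullet> x = of_int n} \<in> null_sets lborel" using null_sets_completion_iff by blast
      then have "AE x in lborel. x \<notin> {x. ?a \<bullet> x = of_int n}" by (rule AE_not_in)
      then show ?thesis by (simp add: inner_diff_left inner_axis')
    qed
    then show ?thesis by (simp add: AE_all_countable)
  qed simp
  then have "AE x in lborel. \<forall>i\<in>UNIV. \<forall>j\<in>UNIV. \<forall>n :: int. i \<noteq> j \<longrightarrow> (x :: real^'n) $ i - x $ j \<noteq> of_int n"
    by (intro AE_finite_allI) auto
  then show ?thesis by (auto elim!: eventually_mono simp: Ints_def)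
qed

lemma alcove_borel [measurable]: "(alcove :: (real^'n::{finite,linorder}) set) \<in> sets borel"
  unfolding alcove_def by measurable

lemma evaluation_measurable:
  "(\<lambda>(\<omega>, y). \<omega> y) \<in> count_space affine_weyl \<Otimes>\<^sub>M restrict_space lborel alcove
     \<rightarrow>\<^sub>M (borel :: (real^'n::{finite,linorder}) measure)"
  by (rule measurable_pair_measure_countable1[OF countable_affine_weyl])
    (auto intro!: measurable_restrict_space1 affine_weyl_measurable simp: measurable_lborel1)

lemma sigma_finite_alcove:
  "sigma_finite_measure (restrict_space (lborel :: (real^'n::{finite,linorder}) measure) alcove)"
  by (rule sigma_finite_measure_restrict_space[OF sigma_finite_lborel]) simp

text \<open>The fundamental domain property as an equality of measures. For fixed
  \<open>\<omega>\<close> the slice over \<open>X\<close> is the part of the alcove sent into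
  \<open>X\<close>, with the same measure as its image; these images are disjoint and fill
  \<open>X\<close> up to the walls.\<close>

lemma distr_evaluation_alcove:
  "distr (count_space affine_weyl \<Otimes>\<^sub>M restrict_space lborel alcove) borel (\<lambda>(\<omega>, y). \<omega> y) =
     (lborel :: (real^'n::{finite,linorder}) measure)"
proof (rule measure_eqI)
  let ?R = "restrict_space (lborel :: ((real, 'n) vec) measure) alcove"
  let ?N = "count_space (affine_weyl :: ((real, 'n) vec \<Rightarrow> (real, 'n) vec) set)"
  interpret R: sigma_finite_measure ?R by (rule sigma_finite_alcove)
  fix X :: "((real, 'n) vec) set"
  assume "X \<in> sets (distr (?N \<Otimes>\<^sub>M ?R) borel (\<lambda>(\<omega>, y). \<omega> y))"
  then have X [measurable]: "X \<in> sets borel" by simp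
  let ?Z = "(\<lambda>(\<omega>, y). \<omega> y) -` X \<inter> space (?N \<Otimes>\<^sub>M ?R)"
  have Z: "?Z \<in> sets (?N \<Otimes>\<^sub>M ?R)" by (rule measurable_sets[OF evaluation_measurable X])
  have S [measurable]: "\<omega> -` X \<inter> alcove \<in> sets borel" if "\<omega> \<in> affine_weyl" for \<omega> :: "(real, 'n) vec \<Rightarrow> (real, 'n) vec"
    using measurable_sets[OF affine_weyl_measurable[OF that] X] by auto
  have "emeasure (distr (?N \<Otimes>\<^sub>M ?R) borel (\<lambda>(\<omega>, y). \<omega> y)) X = emeasure (?N \<Otimes>\<^sub>M ?R) ?Z"
    by (rule emeasure_distr[OF evaluation_measurable X])
  also have "\<dots> = (\<integral>\<^sup>+\<omega>. emeasure ?R (Pair \<omega> -` ?Z) \<partial>?N)"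
    by (rule R.emeasure_pair_measure_alt[OF Z])
  also have "\<dots> = (\<integral>\<^sup>+\<omega>. emeasure lborel (\<omega> ` (\<omega> -` X \<inter> alcove)) \<partial>?N)"
  proof (rule nn_integral_cong)
    fix \<omega> assume "\<omega> \<in> space ?N"
    then have \<omega>: "\<omega> \<in> affine_weyl" by simp
    then have "Pair \<omega> -` ?Z = \<omega> -` X \<inter> alcove"
      by (auto simp: space_pair_measure space_restrict_space)
    then show "emeasure ?R (Pair \<omega> -` ?Z) = emeasure lborel (\<omega> ` (\<omega> -` X \<inter> alcove))"
      using \<omega> by (simp add: emeasure_restrict_space affine_weyl_image(2) S)
  qed
  also have "\<dots> = emeasure lborel (\<Union>\<omega>\<in>affine_weyl. \<omega> ` (\<omega> -` X \<inter> alcove))"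
  proof (rule emeasure_UN_countable[symmetric])
    show "disjoint_family_on (\<lambda>\<omega>. \<omega> ` (\<omega> -` X \<inter> alcove)) affine_weyl"
      unfolding disjoint_family_on_def
    proof (intro ballI impI equals0I)
      fix \<omega> \<omega>' :: "(real, 'n) vec \<Rightarrow> (real, 'n) vec" and x
      assume W: "\<omega> \<in> affine_weyl" "\<omega>' \<in> affine_weyl" "\<omega> \<noteq> \<omega>'"
      assume "x \<in> \<omega> ` (\<omega> -` X \<inter> alcove) \<inter> \<omega>' ` (\<omega>' -` X \<inter> alcove)"
      then obtain y y' where "y \<in> alcove" "y' \<in> alcove" "\<omega> y = \<omega>' y'" by auto
      then show False using alcove_images_disjoint[OF _ _ W(1,2)] W(3) by blast
    qed
  qed (auto simp: countable_affine_weyl affine_weyl_image(1) S)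
  also have "\<dots> = emeasure lborel X"
  proof (rule emeasure_eq_AE)
    show "AE x in lborel. x \<in> (\<Union>\<omega>\<in>affine_weyl. \<omega> ` (\<omega> -` X \<inter> alcove)) \<longleftrightarrow> x \<in> X"
      using AE_coordinate_diff_notin_Ints
    proof eventually_elim
      case (elim x)
      then show ?case using alcove_images_cover[of x] by auto
    qed
    show "(\<Union>\<omega>\<in>affine_weyl. \<omega> ` (\<omega> -` X \<inter> alcove)) \<in> sets lborel"
      unfolding sets_lborel
      by (rule sets.countable_UN'[OF countable_affine_weyl]) (auto intro!: affine_weyl_image(1) S)
  qed simp
  finally show "emeasure (distr (?N \<Otimes>\<^sub>M ?R) borel (\<lambda>(\<omega>, y). \<omega> y)) X = emeasure lborel X" .
qed simp

text \<open>For real terms, unconditional and absolute summability coincide.\<close>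

lemma integrable_count_space_iff_summable_on:
  fixes g :: "'a \<Rightarrow> real"
  shows "integrable (count_space A) g \<longleftrightarrow> g summable_on A"
  using abs_summable_equivalent[of g A] summable_on_iff_abs_summable_on_real[of g A]
  by (simp add: abs_summable_on_def)

lemma integral_count_space_eq_infsum:
  fixes g :: "'a \<Rightarrow> real"
  shows "(LINT x|count_space A. g x) = infsum g A"
proof (cases "g summable_on A")
  case True
  then show ?thesis
    using infsetsum_infsum[of g A] integrable_count_space_iff_summable_on[of A g]
    by (simp add: abs_summable_on_def infsetsum_def)
next
  \<comment> \<open>Both sides have the default value 0.\<close>
  case False
  then show ?thesis
    by (simp add: infsum_not_exists not_integrable_integral_eq integrable_count_space_iff_summable_on)
qed

text \<open>Fubini on the group times the alcove: the orbit sum is the inner integral over counting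
  measure, and the integral over the product is that of \<open>h\<close> by the pushforward
  identity.\<close>

lemma alcove_unfolding:
  fixes h :: "real^'n::{finite,linorder} \<Rightarrow> real"
  assumes h: "integrable lborel h"
  shows "AE y in lborel. y \<in> alcove \<longrightarrow> (\<lambda>\<omega>. h (\<omega> y)) summable_on affine_weyl"
    and "set_integrable lborel alcove (\<lambda>y. \<Sum>\<^sub>\<infinity>\<omega>\<in>affine_weyl. h (\<omega> y))"
    and "(LINT y:alcove|lborel. \<Sum>\<^sub>\<infinity>\<omega>\<in>affine_weyl. h (\<omega> y)) = (LINT x|lborel. h x)"
proof -
  let ?R = "restrict_space (lborel :: ((real, 'n) vec) measure) alcove"
  let ?N = "count_space (affine_weyl :: ((real, 'n) vec \<Rightarrow> (real, 'n) vec) set)"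
  interpret N: sigma_finite_measure ?N
    by (rule sigma_finite_measure_count_space_countable[OF countable_affine_weyl])
  interpret R: sigma_finite_measure ?R by (rule sigma_finite_alcove)
  interpret pair_sigma_finite ?N ?R ..
  have hm: "h \<in> borel_measurable borel" using borel_measurable_integrable[OF h] by simp
  have int: "integrable (?N \<Otimes>\<^sub>M ?R) (case_prod (\<lambda>\<omega> y. h (\<omega> y)))"
    using h integrable_distr_eq[OF evaluation_measurable hm]
    unfolding distr_evaluation_alcove by (simp add: case_prod_unfold)
  have "AE y in ?R. (\<lambda>\<omega>. h (\<omega> y)) summable_on affine_weyl"
    using AE_integrable_snd[OF int] by (simp add: integrable_count_space_iff_summable_on)
  then show "AE y in lborel. y \<in> alcove \<longrightarrow> (\<lambda>\<omega>. h (\<omega> y)) summable_on affine_weyl"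
    by (simp add: AE_restrict_space_iff)
  have "integrable ?R (\<lambda>y. \<Sum>\<^sub>\<infinity>\<omega>\<in>affine_weyl. h (\<omega> y))"
    using integrable_snd[OF int] by (simp add: integral_count_space_eq_infsum)
  then show "set_integrable lborel alcove (\<lambda>y. \<Sum>\<^sub>\<infinity>\<omega>\<in>affine_weyl. h (\<omega> y))"
    by (simp add: set_integrable_def integrable_restrict_space)
  have "(LINT y|?R. (\<Sum>\<^sub>\<infinity>\<omega>\<in>affine_weyl. h (\<omega> y))) =
      (LINT p|(?N \<Otimes>\<^sub>M ?R). (case p of (\<omega>, y) \<Rightarrow> h (\<omega> y)))"
    using integral_snd[OF int] by (simp add: integral_count_space_eq_infsum)
  also have "\<dots> = (LINT x|lborel. h x)"
    using integral_distr[OF evaluation_measurable hm]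
    unfolding distr_evaluation_alcove by (simp add: case_prod_unfold)
  finally show "(LINT y:alcove|lborel. \<Sum>\<^sub>\<infinity>\<omega>\<in>affine_weyl. h (\<omega> y)) = (LINT x|lborel. h x)"
    by (simp add: set_lebesgue_integral_def integral_restrict_space)
qed

section \<open>The Pfaffian of floor signs\<close>

text \<open>This is the function \<open>g\<close> of the overview.\<close>

definition floor_sign_pfaffian :: "real^'n::{finite,linorder} \<Rightarrow> real" where
  "floor_sign_pfaffian x = pfaffian UNIV (\<lambda>i j. (- 1) powi \<lfloor>x $ i - x $ j\<rfloor>)"

lemma prod_Union_pair_partition:
  assumes "finite A" "\<pi> \<in> pair_partitions A"
  shows "(\<Prod>i\<in>A. c i) = (\<Prod>B\<in>\<pi>. c (Min B) * c (Max B))"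
proof -
  note D = pair_partitionsD[OF assms(2)]
  have "(\<Prod>i\<in>\<Union>\<pi>. c i) = (\<Prod>B\<in>\<pi>. prod c B)"
    using D by (subst prod.Union_disjoint) auto
  also have "\<dots> = (\<Prod>B\<in>\<pi>. c (Min B) * c (Max B))"
  proof (rule prod.cong[OF refl])
    fix B assume "B \<in> \<pi>"
    note B = card_2_Min_Max[OF D(2)[OF this]]
    have "prod c B = prod c {Min B, Max B}" by (rule prod.cong[OF B(1) refl])
    then show "prod c B = c (Min B) * c (Max B)" using B(2) by simp
  qed
  finally show ?thesis by (simp add: D(6))
qed

text \<open>Every index lies in exactly one block, so the factors of \<open>tensor f x\<close> can
  be dealt out to the blocks, giving factors in disjoint pairs of variables.\<close>

lemma floor_sign_pfaffian_tensor:
  "floor_sign_pfaffian x * tensor f x =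
    (\<Sum>\<pi>\<in>pair_partitions UNIV. (- 1) ^ crossings \<pi> *
      (\<Prod>B\<in>\<pi>. J_integrand f (Min B) (Max B) (x $ Min B, x $ Max B)))"
  unfolding floor_sign_pfaffian_def pfaffian_def sum_distrib_right
proof (rule sum.cong[OF refl])
  fix \<pi> :: "'a set set" assume \<pi>: "\<pi> \<in> pair_partitions UNIV"
  have "tensor f x = (\<Prod>B\<in>\<pi>. f (Min B) (x $ Min B) * f (Max B) (x $ Max B))"
    unfolding tensor_def by (rule prod_Union_pair_partition[OF finite \<pi>])
  then show "(- 1) ^ crossings \<pi> * (\<Prod>B\<in>\<pi>. (- 1) powi \<lfloor>x $ Min B - x $ Max B\<rfloor>) * tensor f x =
      (- 1) ^ crossings \<pi> * (\<Prod>B\<in>\<pi>. J_integrand f (Min B) (Max B) (x $ Min B, x $ Max B))"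
    by (simp add: J_integrand_def prod.distrib mult.assoc)
qed

lemma has_bochner_integral_floor_sign_pfaffian_tensor:
  fixes f :: "'n::{finite,linorder} \<Rightarrow> real \<Rightarrow> real"
  assumes f: "\<And>i. integrable lborel (f i)"
  shows "has_bochner_integral lborel (\<lambda>x. floor_sign_pfaffian x * tensor f x)
           (pfaffian UNIV (\<lambda>i j. LINT p|lborel. J_integrand f i j p))"
  unfolding floor_sign_pfaffian_tensor pfaffian_def
proof (intro has_bochner_integral_sum has_bochner_integral_mult_right)
  fix \<pi> :: "'n set set" assume \<pi>: "\<pi> \<in> pair_partitions UNIV"
  note D = pair_partitionsD[OF \<pi>]
  let ?F = "\<lambda>x :: (real, 'n) vec. \<Prod>B\<in>\<pi>. J_integrand f (Min B) (Max B) (x $ Min B, x $ Max B)"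
  have [measurable]: "f i \<in> borel_measurable borel" for i
    using borel_measurable_integrable[OF f] by simp
  have F: "?F \<in> borel_measurable borel" unfolding J_integrand_def by measurable
  have props: "finite \<pi>" "disjoint \<pi>" "\<And>B. B \<in> \<pi> \<Longrightarrow> B = {Min B, Max B} \<and> Min B \<noteq> Max B"
    using finite_pair_partition[OF finite \<pi>] D(7) card_2_Min_Max[OF D(2)]
    by (auto simp: disjoint_def less_imp_neq)
  show "has_bochner_integral lborel ?F (\<Prod>B\<in>\<pi>. LINT p|lborel. J_integrand f (Min B) (Max B) p)"
    unfolding has_bochner_integral_iff integrable_lborel_vec[OF F] integral_lborel_vec[OF F]
    using integrable_prod_J_integrand[OF f props] integral_prod_J_integrand[OF f props]
    by (simp add: D(6))
qed

lemma floor_sign_pfaffian_affine_perm: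
  fixes y :: "real^'n::{finite,linorder}"
  assumes "even CARD('n)" "y \<in> alcove" "\<tau> permutes UNIV" "d \<in> root_lattice"
  shows "floor_sign_pfaffian (affine_perm \<tau> d y) = sign \<tau>"
proof -
  let ?x = "affine_perm \<tau> d y"
  have "\<And>i. \<exists>n. d $ i = of_int n" using assms(4) by (auto simp: root_lattice_def Ints_def)
  then obtain a where a: "\<And>i. d $ i = of_int (a i)" by metis
  have "of_int (\<Sum>i\<in>UNIV. a i) = (0 :: real)" using assms(4) by (simp add: root_lattice_def a)
  then have a_sum: "(\<Sum>i\<in>UNIV. a i) = 0" by (simp only: of_int_eq_0_iff)
  let ?s = "\<lambda>i. (- 1) powi a i :: real"
  have prod_s: "(\<Prod>i\<in>UNIV. ?s i) = 1"
  proof -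
    have "(\<Prod>i\<in>S. ?s i) = (- 1) powi (\<Sum>i\<in>S. a i)" for S :: "'n set"
      by (induction S rule: infinite_finite_induct) (auto simp: power_int_add)
    then show ?thesis by (simp add: a_sum)
  qed
  have entry: "(- 1) powi \<lfloor>?x $ i - ?x $ j\<rfloor> = ?s i * ?s j * of_int (order_sign (\<tau> i) (\<tau> j))"
    if "i \<noteq> j" for i j
  proof -
    have ne: "\<tau> i \<noteq> \<tau> j" using that permutes_inj[OF assms(3)] by (auto dest: injD)
    \<comment> \<open>The difference of the two coordinates of \<open>y\<close> lies strictly
      between 0 and 1, or between -1 and 0, according to the order of \<open>\<tau> i\<close> and
      \<open>\<tau> j\<close>; its floor is \<open>?e\<close>.\<close>
    let ?e = "if \<tau> j < \<tau> i then - 1 else 0 :: int"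
    have "\<lfloor>?x $ i - ?x $ j\<rfloor> = a i - a j + ?e"
      using ne alcove_diff[OF assms(2), of "\<tau> i" "\<tau> j"] alcove_diff[OF assms(2), of "\<tau> j" "\<tau> i"]
      by (intro floor_unique) (auto simp: a neq_iff)
    then have "(- 1 :: real) powi \<lfloor>?x $ i - ?x $ j\<rfloor> = (- 1) powi a i * (- 1) powi (- a j) * (- 1) powi ?e"
      by (simp add: power_int_add power_int_diff power_int_minus divide_inverse)
    also have "(- 1 :: real) powi (- a j) = ?s j"
      by (simp add: power_int_minus power_int_inverse[symmetric])
    finally show ?thesis by (auto simp: order_sign_def)
  qed
  have "floor_sign_pfaffian ?x = pfaffian UNIV (\<lambda>i j. of_int (order_sign (\<tau> i) (\<tau> j)))"
    unfolding floor_sign_pfaffian_def pfaffian_def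
  proof (rule sum.cong[OF refl])
    fix \<pi> :: "'n set set" assume \<pi>: "\<pi> \<in> pair_partitions UNIV"
    note D = pair_partitionsD[OF \<pi>]
    have "(\<Prod>B\<in>\<pi>. (- 1 :: real) powi \<lfloor>?x $ Min B - ?x $ Max B\<rfloor>) =
        (\<Prod>B\<in>\<pi>. ?s (Min B) * ?s (Max B)) * (\<Prod>B\<in>\<pi>. of_int (order_sign (\<tau> (Min B)) (\<tau> (Max B))))"
      unfolding prod.distrib[symmetric]
      using card_2_Min_Max(2)[OF D(2)] by (intro prod.cong refl entry) (auto simp: less_imp_neq)
    also have "(\<Prod>B\<in>\<pi>. ?s (Min B) * ?s (Max B)) = 1"
      using prod_Union_pair_partition[OF finite \<pi>, of ?s] prod_s by simp
    finally show "(- 1) ^ crossings \<pi> * (\<Prod>B\<in>\<pi>. (- 1 :: real) powi \<lfloor>?x $ Min B - ?x $ Max B\<rfloor>) =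
        (- 1) ^ crossings \<pi> * (\<Prod>B\<in>\<pi>. of_int (order_sign (\<tau> (Min B)) (\<tau> (Max B))))"
      by simp
  qed
  also have "\<dots> = sign \<tau>"
    using pfaffian_order_sign_permutes[OF finite assms(1,3)] by (simp add: pfaffian_of_int)
  finally show ?thesis .
qed

section \<open>Passage to Lebesgue measurable functions\<close>

lemma AE_lborel_coordinate:
  assumes "AE t in lborel. P t"
  shows "AE x in lborel. P ((x :: real^'n) $ i)"
proof -
  obtain N where N: "N \<in> null_sets lborel" "{t. \<not> P t} \<subseteq> N"
    using assms by (auto simp: eventually_ae_filter)
  have N': "N \<in> sets borel" using N(1) by auto
  let ?P = "Pi\<^sub>M UNIV (\<lambda>_ :: 'n. lborel :: real measure)"
  have pre: "(\<lambda>x :: real^'n. x $ i) -` N \<in> sets borel"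
    using measurable_sets[OF borel_measurable_vec_nth N'] by simp
  have "emeasure lborel ((\<lambda>x :: real^'n. x $ i) -` N) =
      emeasure (distr ?P borel vec_lambda) ((\<lambda>x :: real^'n. x $ i) -` N)"
    by (simp add: distr_vec_lambda_lborel)
  also have "\<dots> = emeasure ?P (Pi\<^sub>E UNIV (\<lambda>j. if j = i then N else UNIV))"
    by (subst emeasure_distr[OF measurable_vec_lambda pre])
      (auto simp: space_PiM PiE_def Pi_def intro!: arg_cong2[where f = emeasure])
  also have "\<dots> = (\<Prod>j\<in>UNIV. emeasure lborel (if j = i then N else UNIV))"
    using N' by (intro lborel_product.emeasure_PiM) auto
  \<comment> \<open>The factor at \<open>i\<close> is 0 and makes the product 0 even though the
    other factors are infinite.\<close>
  also have "\<dots> = 0"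
    using N(1) by (intro prod_zero bexI[of _ i]) auto
  finally have "(\<lambda>x :: real^'n. x $ i) -` N \<in> null_sets lborel"
    using pre by (simp add: null_sets_def)
  then show ?thesis by (rule AE_I') (use N(2) in auto)
qed

lemma AE_lborel_fst_snd:
  assumes "AE t in lborel. P (t :: real)"
  shows "AE p in lborel. P (fst (p :: real \<times> real))" "AE p in lborel. P (snd (p :: real \<times> real))"
proof -
  obtain N where N: "N \<in> null_sets lborel" "{t. \<not> P t} \<subseteq> N"
    using assms by (auto simp: eventually_ae_filter)
  have "emeasure lborel (N \<times> (UNIV :: real set)) = 0" "emeasure lborel ((UNIV :: real set) \<times> N) = 0"
    using N(1) by (simp_all add: lborel_prod[symmetric] lborel.emeasure_pair_measure_Times null_sets_def)
  then have "N \<times> (UNIV :: real set) \<in> null_sets lborel" "(UNIV :: real set) \<times> N \<in> null_sets lborel"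
    using N(1) by (auto simp: null_sets_def borel_prod[symmetric])
  from this(1) show "AE p in lborel. P (fst (p :: real \<times> real))"
    by (rule AE_I') (use N(2) in auto)
  from \<open>UNIV \<times> N \<in> null_sets lborel\<close> show "AE p in lborel. P (snd (p :: real \<times> real))"
    by (rule AE_I') (use N(2) in auto)
qed

lemma weyl_sum_alcove_borel:
  fixes f :: "'n::{finite,linorder} \<Rightarrow> real \<Rightarrow> real"
  assumes "even CARD('n)" and f: "\<And>i. integrable lborel (f i)"
  shows "AE y in lborel. y \<in> alcove \<longrightarrow>
            (\<lambda>\<omega>. weyl_sign \<omega> * tensor f (\<omega> y)) summable_on affine_weyl"
    and "set_integrable lborel alcove
           (\<lambda>y. \<Sum>\<^sub>\<infinity>\<omega>\<in>affine_weyl. weyl_sign \<omega> * tensor f (\<omega> y))"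
    and "(LINT y:alcove|lborel. \<Sum>\<^sub>\<infinity>\<omega>\<in>affine_weyl. weyl_sign \<omega> * tensor f (\<omega> y)) =
         pfaffian UNIV (\<lambda>i j. LINT p|lborel. J_integrand f i j p)"
proof -
  let ?h = "\<lambda>x. floor_sign_pfaffian x * tensor f x"
  have h: "integrable lborel ?h"
    "(LINT x|lborel. ?h x) = pfaffian UNIV (\<lambda>i j. LINT p|lborel. J_integrand f i j p)"
    using has_bochner_integral_floor_sign_pfaffian_tensor[of f, OF f]
    by (simp_all add: has_bochner_integral_iff)
  \<comment> \<open>The sign may replace \<open>floor_sign_pfaffian\<close> only along orbits that
    start in the alcove, which is why all three claims are restricted to it.\<close>
  have eq: "?h (\<omega> y) = weyl_sign \<omega> * tensor f (\<omega> y)" if "y \<in> alcove" "\<omega> \<in> affine_weyl" for y \<omega>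
    using that by (auto simp: affine_weyl_eq floor_sign_pfaffian_affine_perm[OF assms(1)] weyl_sign_affine_perm)
  have sum_eq: "(\<Sum>\<^sub>\<infinity>\<omega>\<in>affine_weyl. ?h (\<omega> y)) = (\<Sum>\<^sub>\<infinity>\<omega>\<in>affine_weyl. weyl_sign \<omega> * tensor f (\<omega> y))"
    if "y \<in> alcove" for y
    by (rule infsum_cong) (rule eq[OF that])
  show "AE y in lborel. y \<in> alcove \<longrightarrow>
      (\<lambda>\<omega>. weyl_sign \<omega> * tensor f (\<omega> y)) summable_on affine_weyl"
    using alcove_unfolding(1)[OF h(1)]
    by eventually_elim (auto simp: eq cong: summable_on_cong)
  show "set_integrable lborel alcove
      (\<lambda>y. \<Sum>\<^sub>\<infinity>\<omega>\<in>affine_weyl. weyl_sign \<omega> * tensor f (\<omega> y))"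
    using alcove_unfolding(2)[OF h(1)] sum_eq by (simp cong: set_integrable_cong)
  have "(LINT y:alcove|lborel. \<Sum>\<^sub>\<infinity>\<omega>\<in>affine_weyl. weyl_sign \<omega> * tensor f (\<omega> y)) =
      (LINT y:alcove|lborel. \<Sum>\<^sub>\<infinity>\<omega>\<in>affine_weyl. ?h (\<omega> y))"
    by (rule set_lebesgue_integral_cong) (auto simp: sum_eq)
  then show "(LINT y:alcove|lborel. \<Sum>\<^sub>\<infinity>\<omega>\<in>affine_weyl. weyl_sign \<omega> * tensor f (\<omega> y)) =
      pfaffian UNIV (\<lambda>i j. LINT p|lborel. J_integrand f i j p)"
    using alcove_unfolding(3)[OF h(1)] h(2) by simp
qed

text \<open>Completeness of \<open>lebesgue\<close> makes \<open>F\<close> measurable from its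
  agreement with \<open>G\<close> off a null set.\<close>

lemma integrable_lebesgue_AE_cong:
  fixes F G :: "'a::euclidean_space \<Rightarrow> real"
  assumes "integrable lborel G" "AE x in lborel. G x = F x"
  shows "integrable lebesgue F" "(LINT x|lebesgue. F x) = (LINT x|lborel. G x)"
proof -
  have Gm: "G \<in> borel_measurable lborel" using assms(1) by (rule borel_measurable_integrable)
  have G: "integrable lebesgue G" "(LINT x|lebesgue. G x) = (LINT x|lborel. G x)"
    using assms(1) Gm by (simp_all add: integrable_completion integral_completion)
  have ae: "AE x in lebesgue. G x = F x" using assms(2) by (rule AE_completion)
  have F: "F \<in> borel_measurable lebesgue"
    by (rule borel_measurable_AE[OF borel_measurable_integrable[OF G(1)] ae])
  show "integrable lebesgue F" by (rule integrable_cong_AE_imp[OF G(1) F ae])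
  show "(LINT x|lebesgue. F x) = (LINT x|lborel. G x)"
    using integral_cong_AE[OF borel_measurable_integrable[OF G(1)] F ae] G(2) by simp
qed

theorem proposition15:
  fixes f :: "'n::{finite,linorder} \<Rightarrow> real \<Rightarrow> real"
  assumes "CARD('n) \<ge> 2" and "even CARD('n)"
    and "\<And>i. integrable lebesgue (f i)"
  shows "(AE y in lebesgue. y \<in> alcove \<longrightarrow>
            (\<lambda>\<omega>. weyl_sign \<omega> * tensor f (\<omega> y)) summable_on affine_weyl)
       \<and> set_integrable lebesgue alcove
           (\<lambda>y. \<Sum>\<^sub>\<infinity>\<omega>\<in>affine_weyl. weyl_sign \<omega> * tensor f (\<omega> y))
       \<and> (\<forall>i j. integrable lebesgue (J_integrand f i j))
       \<and> (LINT y:alcove|lebesgue. \<Sum>\<^sub>\<infinity>\<omega>\<in>affine_weyl. weyl_sign \<omega> * tensor f (\<omega> y))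
         = pfaffian UNIV (J f)"
proof -
  have "\<exists>g. g \<in> borel_measurable lborel \<and> (AE t in lborel. f i t = g t)" for i
    using completion_ex_borel_measurable_real[OF borel_measurable_integrable[OF assms(3)[of i]]] by blast
  then obtain g where g_meas: "\<And>i. g i \<in> borel_measurable lborel"
    and fg: "\<And>i. AE t in lborel. f i t = g i t" by metis
  have g: "integrable lborel (g i)" for i
  proof -
    have "integrable lebesgue (g i)"
      using assms(3)[of i] measurable_completion[OF g_meas[of i]] AE_completion[OF fg[of i]]
      by (rule integrable_cong_AE_imp)
    then show ?thesis using integrable_completion[OF g_meas[of i]] by simp
  qed
  have J_ae: "AE p in lborel. J_integrand g i j p = J_integrand f i j p" for i j
    using AE_lborel_fst_snd(1)[OF fg[of i]] AE_lborel_fst_snd(2)[OF fg[of j]]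
    by eventually_elim (simp add: J_integrand_def case_prod_unfold)
  have J: "integrable lebesgue (J_integrand f i j)"
    "J f i j = (LINT p|lborel. J_integrand g i j p)" for i j
    using integrable_lebesgue_AE_cong[OF integrable_J_integrand[OF g] J_ae] by (simp_all add: J_def)
  have "AE x in lborel. \<forall>i\<in>UNIV. f i (x $ i) = g i (x $ i)"
    by (rule AE_finite_allI) (auto intro: AE_lborel_coordinate[OF fg])
  then have tensor_ae: "AE x in lborel. tensor f x = tensor g x"
    by eventually_elim (simp add: tensor_def)
  \<comment> \<open>The exceptional set of \<open>tensor_ae\<close> is pulled back by each
    \<open>\<omega>\<close> to a null set, as \<open>\<omega>\<close> preserves
    \<open>lborel\<close>; countably many null sets have a null union.\<close>
  have "AE y in lborel. \<forall>\<omega>\<in>affine_weyl. tensor f (\<omega> y) = tensor g (\<omega> y)"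
  proof (rule AE_ball_countable'[OF _ countable_affine_weyl])
    fix \<omega> :: "(real, 'n) vec \<Rightarrow> (real, 'n) vec" assume "\<omega> \<in> affine_weyl"
    then have \<omega>: "\<omega> \<in> lborel \<rightarrow>\<^sub>M borel" "distr lborel borel \<omega> = lborel"
      by (simp_all add: affine_weyl_measurable distr_affine_weyl)
    show "AE y in lborel. tensor f (\<omega> y) = tensor g (\<omega> y)"
      by (rule AE_distrD[OF \<omega>(1)]) (simp only: \<omega>(2) tensor_ae)
  qed
  \<comment> \<open>On this common set the sums agree term by term, so summability and value agree
    together, divergent sums included.\<close>
  then have orbit_ae: "AE y in lborel.
      ((\<lambda>\<omega>. weyl_sign \<omega> * tensor f (\<omega> y)) summable_on affine_weyl \<longleftrightarrow>
       (\<lambda>\<omega>. weyl_sign \<omega> * tensor g (\<omega> y)) summable_on affine_weyl) \<and>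
      (\<Sum>\<^sub>\<infinity>\<omega>\<in>affine_weyl. weyl_sign \<omega> * tensor f (\<omega> y)) =
      (\<Sum>\<^sub>\<infinity>\<omega>\<in>affine_weyl. weyl_sign \<omega> * tensor g (\<omega> y))"
    by eventually_elim (auto cong: summable_on_cong infsum_cong)
  note main = weyl_sum_alcove_borel[OF assms(2) g]
  have "AE y in lborel. y \<in> alcove \<longrightarrow>
      (\<lambda>\<omega>. weyl_sign \<omega> * tensor f (\<omega> y)) summable_on affine_weyl"
    using main(1) orbit_ae by eventually_elim simp
  then have summable: "AE y in lebesgue. y \<in> alcove \<longrightarrow>
      (\<lambda>\<omega>. weyl_sign \<omega> * tensor f (\<omega> y)) summable_on affine_weyl"
    by (rule AE_completion)
  have "AE y in lborel.
      indicator alcove y *\<^sub>R (\<Sum>\<^sub>\<infinity>\<omega>\<in>affine_weyl. weyl_sign \<omega> * tensor g (\<omega> y)) =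
      indicat_real alcove y *\<^sub>R (\<Sum>\<^sub>\<infinity>\<omega>\<in>affine_weyl. weyl_sign \<omega> * tensor f (\<omega> y))"
    using orbit_ae by eventually_elim simp
  note transfer = integrable_lebesgue_AE_cong[OF main(2)[unfolded set_integrable_def] this]
  have "pfaffian UNIV (J f) = pfaffian UNIV (\<lambda>i j. LINT p|lborel. J_integrand g i j p)"
    by (simp add: pfaffian_def J(2))
  then show ?thesis
    using summable transfer main(3) J(1) by (simp add: set_integrable_def set_lebesgue_integral_def)
qed

end
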